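(* For every graph class $\mathcal{C}$ of bounded expansion there is an absolute constant $c$ such that for any $G \in \mathcal{C}$, the adjacent closed vertex-distinguishing number satisfies $\operatorname{dis}[G] \leq c$. In particular, there exists such a constant $c$ for the class of all planar graphs.
   Context: All graphs are simple, finite and undirected. $N[v]$ denotes the closed neighborhood of a vertex $v$. An assignment of positive integers (labels) to the vertices of a graph $G$ is called distinguishing if for every pair of adjacent vertices $u,v$ with $N[u]\neq N[v]$, the sum of the labels over $N[u]$ differs from the sum of the labels over $N[v]$. The adjacent closed vertex-distinguishing number $\operatorname{dis}[G]$ is the smallest positive integer $\ell$ such that $G$ has a distinguishing labeling with labels in $\{1,\ldots,\ell\}$. Shallow minors: for a graph $H$ and an integer $d\geq 0$, a graph $G$ with vertex set $\{v_1,\ldots,v_n\}$ is a $d$-shallow minor of $H$ if there are pairwise disjoint vertex subsets $B_1,\ldots,B_n$ of $H$ such that each $B_i$ induces a connected subgraph of $H$ of radius at most $d$ (some vertex is within distance $d$ of all others), and for each edge $v_iv_j$ of $G$ there is an edge of $H$ with one endpoint in $B_i$ and the other in $B_j$. A class $\mathcal{C}$ of graphs is of bounded expansion if for every integer $d\geq 0$ there is a constant $a_d=a(d,\mathcal{C})$ such that every $d$-shallow minor $G$ of a graph in $\mathcal{C}$ satisfies $|E(G)|\leq a_d|V(G)|$. *)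

theory Defs
  imports "HOL-Analysis.Analysis" "HOL-Library.Disjoint_Sets" "HOL-Library.Nat_Bijection"
begin

record 'a sgraph =
  verts :: "'a set"
  edges :: "'a set set"

definition simple_graph :: "'a sgraph \<Rightarrow> bool" where
  "simple_graph G \<longleftrightarrow>
     finite (verts G) \<and> (\<forall>e\<in>edges G. e \<subseteq> verts G \<and> card e = 2)"

definition closed_nbhd :: "'a sgraph \<Rightarrow> 'a \<Rightarrow> 'a set" where
  "closed_nbhd G v = insert v {u. {u, v} \<in> edges G}"

definition distinguishing :: "'a sgraph \<Rightarrow> ('a \<Rightarrow> nat) \<Rightarrow> bool" where
  "distinguishing G f \<longleftrightarrow>
     (\<forall>u v. {u, v} \<in> edges G \<and> closed_nbhd G u \<noteq> closed_nbhd G v \<longrightarrow>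
        sum f (closed_nbhd G u) \<noteq> sum f (closed_nbhd G v))"

definition dis :: "'a sgraph \<Rightarrow> nat" where
  "dis G = (LEAST l. l \<ge> 1 \<and>
     (\<exists>f. (\<forall>v\<in>verts G. f v \<in> {1..l}) \<and> distinguishing G f))"

definition induced_subgraph :: "'a sgraph \<Rightarrow> 'a set \<Rightarrow> 'a sgraph" where
  "induced_subgraph G B =
     \<lparr>verts = verts G \<inter> B, edges = {e \<in> edges G. e \<subseteq> B}\<rparr>"

definition within_distance :: "'a sgraph \<Rightarrow> nat \<Rightarrow> 'a \<Rightarrow> 'a \<Rightarrow> bool" where
  "within_distance G d u v \<longleftrightarrow>
     (\<exists>k\<le>d. (u, v) \<in> {(x, y). {x, y} \<in> edges G} ^^ k)"

text \<open>The existence of a centre makes the graph nonempty and connected.\<close>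

definition connected_radius_le :: "'a sgraph \<Rightarrow> nat \<Rightarrow> bool" where
  "connected_radius_le G d \<longleftrightarrow>
     (\<exists>u\<in>verts G. \<forall>v\<in>verts G. within_distance G d u v)"

text \<open>The minor and the host graph share a vertex type. Nothing is lost: the branch sets are
  nonempty and disjoint, so a minor never has more vertices than its host, and hence has an
  isomorphic copy on vertices of the host.\<close>

definition shallow_minor :: "nat \<Rightarrow> 'a sgraph \<Rightarrow> 'a sgraph \<Rightarrow> bool" where
  "shallow_minor d G H \<longleftrightarrow> simple_graph G \<and>
     (\<exists>B. disjoint_family_on B (verts G) \<and>
        (\<forall>v\<in>verts G. B v \<subseteq> verts H \<and> connected_radius_le (induced_subgraph H (B v)) d) \<and>
        (\<forall>u v. {u, v} \<in> edges G \<longrightarrow> (\<exists>x\<in>B u. \<exists>y\<in>B v. {x, y} \<in> edges H)))"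

definition bounded_expansion :: "'a sgraph set \<Rightarrow> bool" where
  "bounded_expansion C \<longleftrightarrow> (\<forall>H\<in>C. simple_graph H) \<and>
     (\<forall>d. \<exists>a::real. \<forall>H\<in>C. \<forall>G. shallow_minor d G H \<longrightarrow>
        real (card (edges G)) \<le> a * real (card (verts G)))"

text \<open>A drawing in the plane without crossings: vertices are distinct points, edges are simple
  arcs joining the points of their ends and avoiding all other vertices, and two different edges
  meet only in common ends.\<close>

definition planar :: "'a sgraph \<Rightarrow> bool" where
  "planar G \<longleftrightarrow> simple_graph G \<and>
     (\<exists>(p :: 'a \<Rightarrow> complex) (\<gamma> :: 'a set \<Rightarrow> real \<Rightarrow> complex).
        inj_on p (verts G) \<and>
        (\<forall>e\<in>edges G. arc (\<gamma> e) \<and> {pathstart (\<gamma> e), pathfinish (\<gamma> e)} = p ` e \<and>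
           path_image (\<gamma> e) \<inter> p ` verts G = p ` e) \<and>
        (\<forall>e\<in>edges G. \<forall>f\<in>edges G. e \<noteq> f \<longrightarrow>
           path_image (\<gamma> e) \<inter> path_image (\<gamma> f) = p ` (e \<inter> f)))"

text \<open>Every simple graph has a distinguishing labelling, by distinct powers of two, so the least
  number in the definition of \<^const>\<open>dis\<close> is attained.\<close>

lemma sum_pow2_inj:
  fixes h :: "'a \<Rightarrow> nat"
  assumes "finite A" "finite B" "inj_on h (A \<union> B)"
    and eq: "(\<Sum>x\<in>A. 2 ^ h x) = (\<Sum>x\<in>B. (2::nat) ^ h x)"
  shows "A = B"
proof -
  have A: "inj_on h A" and B: "inj_on h B"
    using assms(3) by (auto intro: inj_on_subset)
  have "(\<Sum>i\<in>h ` A. 2 ^ i) = (\<Sum>i\<in>h ` B. (2::nat) ^ i)"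
    using eq by (simp add: sum.reindex[OF A] sum.reindex[OF B])
  then have "set_encode (h ` A) = set_encode (h ` B)"
    by (simp add: set_encode_def)
  then have "h ` A = h ` B"
    using assms(1,2) by (simp add: set_encode_eq)
  then show ?thesis
    using inj_on_image_eq_iff[OF assms(3), of A B] by simp
qed

lemma dis_attained:
  assumes "simple_graph G"
  shows "dis G \<ge> 1 \<and> (\<exists>f. (\<forall>v\<in>verts G. f v \<in> {1..dis G}) \<and> distinguishing G f)"
proof -
  have fin: "finite (verts G)"
    using assms by (simp add: simple_graph_def)
  then obtain h :: "'a \<Rightarrow> nat" where h: "inj_on h (verts G)"
    using finite_imp_inj_to_nat_seg by blast
  define f where "f = (\<lambda>v. (2::nat) ^ h v)"
  define l where "l = Suc (sum f (verts G))"
  have sub: "closed_nbhd G v \<subseteq> verts G" if "v \<in> verts G" for v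
    using assms that by (auto simp: closed_nbhd_def simple_graph_def)
  have "distinguishing G f"
    unfolding distinguishing_def
  proof (intro allI impI notI)
    fix u v
    assume uv: "{u, v} \<in> edges G \<and> closed_nbhd G u \<noteq> closed_nbhd G v"
      and eq: "sum f (closed_nbhd G u) = sum f (closed_nbhd G v)"
    have "u \<in> verts G" "v \<in> verts G"
      using uv assms by (auto simp: simple_graph_def)
    then have s: "closed_nbhd G u \<subseteq> verts G" "closed_nbhd G v \<subseteq> verts G"
      using sub by auto
    have "closed_nbhd G u = closed_nbhd G v"
    proof (rule sum_pow2_inj)
      show "inj_on h (closed_nbhd G u \<union> closed_nbhd G v)"
        using h s by (auto intro: inj_on_subset)
    qed (use s fin eq in \<open>auto intro: finite_subset simp: f_def\<close>)
    with uv show False by simp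
  qed
  moreover have "f v \<in> {1..l}" if "v \<in> verts G" for v
    using member_le_sum[of v "verts G" f] that fin by (auto simp: l_def f_def)
  ultimately have "l \<ge> 1 \<and> (\<exists>f. (\<forall>v\<in>verts G. f v \<in> {1..l}) \<and> distinguishing G f)"
    by (auto simp: l_def)
  then show ?thesis
    unfolding dis_def by (rule LeastI)
qed

end

(* Bounded expansion makes the graph of "fraternal" pairs sparse: two vertices with arcs to a common
   vertex are joined by a short path, and these paths yield a dense shallow minor if there are too
   many pairs. Hence one can orient the graph, add oriented arcs for fraternal pairs, repeat a bounded
   number of times, and keep all indegrees bounded. A colouring of the last digraph with boundedly
   many colours separates any two vertices from which walks of length at most three along the first
   orientation meet.

   For such a colouring the sets N[v] restricted to one colour class are, as v runs over a class, equal
   or disjoint. For each triple of colours this gives a set T that meets N[u] and N[v] in at most two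
   vertices, and in different numbers whenever an edge uv has these colours and N[u], N[v] differ in
   the third colour. The indicators of the boundedly many sets T are residues of one label modulo
   distinct odd primes.

   Planar graphs have bounded expansion: a dense minor contains a K_6 minor by Mader's theorem, hence a
   K_{3,3} minor, which yields a theta curve in the plane together with a point off it that is joined
   to all three arcs, each time off the other two. The theta curve theorem forbids this; an inversion
   reduces to the case in which one of the arcs is inside the closed curve of the other two. *)

theory Submission
  imports Defs "HOL-Number_Theory.Cong"
begin

subsection \<open>Connected vertex sets\<close>

text \<open>Closed neighbourhoods have unbounded size, so sums of bounded labels can be controlled
  only modulo fixed numbers. A residue sees how many points of a set T lie in N[v]; if this count is
  at most 2, an odd prime modulus recovers it. Hence T may meet the two neighbourhoods of an edge at
  most twice, and yet a bounded number of sets must serve all edges at once. The points of T are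
  therefore chosen locally: those that separate N[u] from N[v] lie among the vertices reached from
  the tail u by at most two arcs, and such regions are disjoint for distinct tails of one colour.
  Passing from such a region to the head v, or from an in-neighbour of u through u and v to an
  out-neighbour of v, takes three arcs in total; this is the origin of the length three. Two such
  walks have total length six, and each augmentation shortens a meeting pair of walks by at least
  one: hence six augmentations. New arcs stand for longer and longer connections in the graph.
  Besides the indegree, two bounds are therefore carried along: the size of a connection, and the
  number of connections through one vertex. They allow disjoint connections to be picked
  greedily.\<close>

definition conn :: "('a \<times> 'a) set \<Rightarrow> 'a set \<Rightarrow> bool" where
  "conn E S \<longleftrightarrow> (\<forall>x\<in>S. \<forall>y\<in>S. (x, y) \<in> (E \<inter> S \<times> S)\<^sup>*)"

lemma conn_mono_rtrancl: "S \<subseteq> T \<Longrightarrow> (x, y) \<in> (E \<inter> S \<times> S)\<^sup>* \<Longrightarrow> (x, y) \<in> (E \<inter> T \<times> T)\<^sup>*"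
  using rtrancl_mono[of "E \<inter> S \<times> S" "E \<inter> T \<times> T"] by blast

lemma conn_singleton [simp]: "conn E {x}"
  by (simp add: conn_def)

lemma conn_Un:
  assumes "conn E S" "conn E T" "z \<in> S" "z \<in> T"
  shows "conn E (S \<union> T)"
proof -
  let ?R = "(E \<inter> (S \<union> T) \<times> (S \<union> T))\<^sup>*"
  have "(x, z) \<in> ?R \<and> (z, x) \<in> ?R" if "x \<in> S \<union> T" for x
    using that assms conn_mono_rtrancl[of S "S \<union> T"] conn_mono_rtrancl[of T "S \<union> T"]
    unfolding conn_def by blast
  then show ?thesis unfolding conn_def by (meson rtrancl_trans)
qed

lemma conn_edge: "sym E \<Longrightarrow> (x, y) \<in> E \<Longrightarrow> conn E {x, y}"
  unfolding conn_def by (auto intro!: r_into_rtrancl dest: symD)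

lemma conn_join:
  assumes "sym E" "conn E S" "conn E T" "x \<in> S" "y \<in> T" "(x, y) \<in> E"
  shows "conn E (S \<union> T)"
proof -
  have "conn E ((S \<union> {x, y}) \<union> T)"
    using assms by (intro conn_Un[of E _ _ y] conn_Un[of E S _ x] conn_edge) auto
  moreover have "(S \<union> {x, y}) \<union> T = S \<union> T" using assms by auto
  ultimately show ?thesis by simp
qed

lemma conn_neighbour:
  assumes "conn E S" "x \<in> S" "y \<in> S" "x \<noteq> y"
  obtains z where "z \<in> S" "(x, z) \<in> E"
  using assms unfolding conn_def by (metis IntD1 IntD2 SigmaD2 converse_rtranclE)

definition adjacency :: "'a sgraph \<Rightarrow> ('a \<times> 'a) set" where
  "adjacency G = {(x, y). {x, y} \<in> edges G}"

lemma sym_adjacency: "sym (adjacency G)"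
  by (auto simp: sym_def adjacency_def insert_commute)

lemma adjacency_verts:
  assumes "simple_graph G" "(x, y) \<in> adjacency G"
  shows "x \<in> verts G" "y \<in> verts G" "x \<noteq> y"
  using assms by (auto simp: simple_graph_def adjacency_def)

subsection \<open>Density of graphs realised by short paths\<close>

text \<open>The bound is imposed on every vertex subset, so it survives deletions and yields
  degeneracy.\<close>

definition sparse_on :: "nat \<Rightarrow> 'a set \<Rightarrow> ('a \<times> 'a) set \<Rightarrow> bool" where
  "sparse_on c V F \<longleftrightarrow> (\<forall>X\<subseteq>V. card (F \<inter> X \<times> X) \<le> c * card X)"

lemma low_degree_vertex:
  assumes V: "finite V" "V \<noteq> {}" and F: "sparse_on c V F"
  obtains v where "v \<in> V" "card {u \<in> V. (u, v) \<in> F} \<le> c"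
proof -
  have "\<exists>v\<in>V. card {u \<in> V. (u, v) \<in> F} \<le> c"
  proof (rule ccontr)
    assume "\<not> ?thesis"
    then have big: "c < card {u \<in> V. (u, v) \<in> F}" if "v \<in> V" for v
      using that by (meson not_le)
    have "F \<inter> V \<times> V = (\<lambda>(v, u). (u, v)) ` (SIGMA v:V. {u \<in> V. (u, v) \<in> F})"
      by (auto simp: image_iff)
    moreover have "inj_on (\<lambda>(v, u). (u, v)) (SIGMA v:V. {u \<in> V. (u, v) \<in> F})"
      by (auto simp: inj_on_def)
    ultimately have "card (F \<inter> V \<times> V) = (\<Sum>v\<in>V. card {u \<in> V. (u, v) \<in> F})"
      using V(1) by (simp add: card_image)
    also have "(\<Sum>v\<in>V. c) < \<dots>" using V big by (intro sum_strict_mono) auto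
    also have "card (F \<inter> V \<times> V) \<le> c * card V" using F by (simp add: sparse_on_def)
    finally show False by simp
  qed
  then show thesis using that by blast
qed

lemma sparse_on_mono:
  assumes "sparse_on c V F" "W \<subseteq> V"
  shows "sparse_on c W F"
  using assms order_trans[of _ W V] by (simp add: sparse_on_def)

text \<open>Degeneracy: a vertex of low degree is removed and all its pairs are directed into it, so
  they add nothing to the indegrees of the remaining vertices.\<close>

lemma sparse_orientation:
  assumes "finite V" "sparse_on c V F" "F \<subseteq> V \<times> V" "sym F"
  shows "\<exists>A\<subseteq>F. F \<subseteq> A \<union> A\<inverse> \<and> (\<forall>v. card {u. (u, v) \<in> A} \<le> c)"
  using assms
proof (induction V arbitrary: F rule: finite_psubset_induct)
  case (psubset V)
  show ?case
  proof (cases "V = {}")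
    case True
    then show ?thesis using psubset.prems by auto
  next
    case False
    obtain v where v: "v \<in> V" "card {u \<in> V. (u, v) \<in> F} \<le> c"
      using low_degree_vertex[OF psubset.hyps(1) False psubset.prems(1)] by blast
    let ?V = "V - {v}"
    let ?F = "F \<inter> ?V \<times> ?V"
    have "sparse_on c ?V ?F"
      unfolding sparse_on_def
    proof (intro allI impI)
      fix X assume X: "X \<subseteq> ?V"
      have "?F \<inter> X \<times> X = F \<inter> X \<times> X" using X by auto
      then show "card (?F \<inter> X \<times> X) \<le> c * card X"
        using sparse_on_mono[OF psubset.prems(1), of ?V] X unfolding sparse_on_def by auto
    qed
    moreover have "sym ?F" using psubset.prems(3) by (auto simp: sym_def)
    moreover have "?V \<subset> V" "?F \<subseteq> ?V \<times> ?V" using v(1) by auto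
    ultimately have "\<exists>A\<subseteq>?F. ?F \<subseteq> A \<union> A\<inverse> \<and> (\<forall>w. card {u. (u, w) \<in> A} \<le> c)"
      using psubset.IH[of ?V ?F] by blast
    then obtain A where A: "A \<subseteq> ?F" "?F \<subseteq> A \<union> A\<inverse>" "\<And>w. card {u. (u, w) \<in> A} \<le> c"
      by blast
    let ?A = "A \<union> {(u, w). (u, w) \<in> F \<and> w = v}"
    have "?A \<subseteq> F" using A(1) by auto
    moreover have "F \<subseteq> ?A \<union> ?A\<inverse>"
    proof
      fix e assume e: "e \<in> F"
      obtain x y where xy: "e = (x, y)" by (cases e)
      have "(y, x) \<in> F" using e xy psubset.prems(3) by (auto dest: symD)
      moreover have "x \<in> V" "y \<in> V" using e xy psubset.prems(2) by auto
      ultimately show "e \<in> ?A \<union> ?A\<inverse>" using A(2) e xy by (cases "x = v \<or> y = v") auto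
    qed
    moreover have "card {u. (u, w) \<in> ?A} \<le> c" for w
    proof (cases "w = v")
      case True
      have "{u. (u, w) \<in> ?A} = {u \<in> V. (u, v) \<in> F}"
        using A(1) psubset.prems(2) True by auto
      then show ?thesis using v(2) by simp
    next
      case False
      then show ?thesis using A(3)[of w] by simp
    qed
    ultimately show ?thesis by (intro exI[of _ ?A] conjI allI)
  qed
qed

text \<open>Greedy colouring along a degeneracy order: at most \<open>c\<close> neighbours leave one
  of the \<open>c + 1\<close> colours free.\<close>

lemma sparse_colouring:
  assumes "finite V" "sparse_on c V F" "sym F"
  shows "\<exists>f. (\<forall>v\<in>V. f v \<le> c) \<and> (\<forall>u\<in>V. \<forall>v\<in>V. u \<noteq> v \<and> (u, v) \<in> F \<longrightarrow> f u \<noteq> f v)"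
  using assms(1,2)
proof (induction V rule: finite_psubset_induct)
  case (psubset V)
  show ?case
  proof (cases "V = {}")
    case True
    then show ?thesis by simp
  next
    case False
    obtain v where v: "v \<in> V" "card {u \<in> V. (u, v) \<in> F} \<le> c"
      using low_degree_vertex[OF psubset.hyps(1) False psubset.prems] by blast
    have "V - {v} \<subset> V" using v by auto
    then obtain f where f: "\<forall>u\<in>V - {v}. f u \<le> c"
        "\<forall>u\<in>V - {v}. \<forall>w\<in>V - {v}. u \<noteq> w \<and> (u, w) \<in> F \<longrightarrow> f u \<noteq> f w"
      using psubset.IH[of "V - {v}"] sparse_on_mono[OF psubset.prems, of "V - {v}"] by auto
    have fin: "finite {u \<in> V. (u, v) \<in> F}" using psubset.hyps by simp
    have "card (f ` {u \<in> V. (u, v) \<in> F}) < card {..c}"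
      using card_image_le[OF fin, of f] v(2) by simp
    then have "\<not> {..c} \<subseteq> f ` {u \<in> V. (u, v) \<in> F}"
      using card_mono[OF finite_imageI[OF fin, of f], of "{..c}"] by linarith
    then obtain k where k: "k \<le> c" "k \<notin> f ` {u \<in> V. (u, v) \<in> F}" by auto
    have new: "k \<noteq> f u" if "u \<in> V" "(u, v) \<in> F \<or> (v, u) \<in> F" for u
      using k(2) that assms(3) by (auto dest: symD)
    show ?thesis
      using f k(1) new by (intro exI[of _ "f(v := k)"]) auto
  qed
qed

text \<open>The set \<open>I (u, v)\<close> contains the inner vertices of a short walk from \<open>u\<close> to \<open>v\<close>.\<close>

definition witnessed :: "'a sgraph \<Rightarrow> ('a \<times> 'a) set \<Rightarrow> ('a \<times> 'a \<Rightarrow> 'a set) \<Rightarrow> nat \<Rightarrow> nat \<Rightarrow> bool" where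
  "witnessed H F I L m \<longleftrightarrow> F \<subseteq> verts H \<times> verts H \<and> irrefl F \<and>
     (\<forall>u v. (u, v) \<in> F \<longrightarrow> I (u, v) \<subseteq> verts H \<and> card (I (u, v)) \<le> L \<and>
        conn (adjacency H) (insert u (I (u, v))) \<and> conn (adjacency H) (insert v (I (u, v))) \<and>
        conn (adjacency H) (insert u (insert v (I (u, v))))) \<and>
     (\<forall>z. card {e \<in> F. z \<in> I e} \<le> m)"

lemma relpow_mono: "(R :: ('a \<times> 'a) set) \<subseteq> S \<Longrightarrow> R ^^ k \<subseteq> S ^^ k"
  by (induction k) (simp_all add: relcomp_mono)

lemma witnessedD:
  assumes "witnessed H F I L m"
  shows "F \<subseteq> verts H \<times> verts H" "irrefl F" "card {e \<in> F. z \<in> I e} \<le> m"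
    "e \<in> F \<Longrightarrow> I e \<subseteq> verts H" "e \<in> F \<Longrightarrow> card (I e) \<le> L"
    "(u, v) \<in> F \<Longrightarrow> u \<noteq> v"
    "(u, v) \<in> F \<Longrightarrow> conn (adjacency H) (insert u (I (u, v)))"
    "(u, v) \<in> F \<Longrightarrow> conn (adjacency H) (insert v (I (u, v)))"
    "(u, v) \<in> F \<Longrightarrow> conn (adjacency H) (insert u (insert v (I (u, v))))"
proof -
  show "F \<subseteq> verts H \<times> verts H" "irrefl F" "card {e \<in> F. z \<in> I e} \<le> m"
    "(u, v) \<in> F \<Longrightarrow> conn (adjacency H) (insert u (I (u, v)))"
    "(u, v) \<in> F \<Longrightarrow> conn (adjacency H) (insert v (I (u, v)))"
    "(u, v) \<in> F \<Longrightarrow> conn (adjacency H) (insert u (insert v (I (u, v))))"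
    using assms by (simp_all add: witnessed_def)
  show "e \<in> F \<Longrightarrow> I e \<subseteq> verts H" "e \<in> F \<Longrightarrow> card (I e) \<le> L"
    using assms by (cases e; simp add: witnessed_def)+
  show "(u, v) \<in> F \<Longrightarrow> u \<noteq> v" using assms by (auto simp: witnessed_def irrefl_def)
qed

text \<open>A walk between two points can be shortened until it has at most as many steps as the
  relation has pairs. This crude count is the source of all the depths of the form
  \<open>Suc L * Suc L\<close>.\<close>

lemma conn_within_distance:
  assumes S: "conn (adjacency H) S" "finite S" "S \<subseteq> T" "x \<in> S" "y \<in> S"
  shows "within_distance (induced_subgraph H T) (card S * card S) x y"
proof -
  let ?R = "adjacency H \<inter> S \<times> S"
  have "finite ?R" using S(2) by blast
  moreover have "(x, y) \<in> ?R\<^sup>*" using S by (simp add: conn_def)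
  ultimately obtain k where k: "k \<le> card ?R" "(x, y) \<in> ?R ^^ k"
    using rtrancl_finite_eq_relpow[of ?R] by auto
  have "card ?R \<le> card (S \<times> S)" using S(2) by (intro card_mono) auto
  then have "k \<le> card S * card S" using k(1) by (simp add: card_cartesian_product)
  moreover have "?R \<subseteq> {(x, y). {x, y} \<in> edges (induced_subgraph H T)}"
    using S(3) by (auto simp: adjacency_def induced_subgraph_def)
  then have "(x, y) \<in> {(x, y). {x, y} \<in> edges (induced_subgraph H T)} ^^ k"
    using k(2) relpow_mono by blast
  ultimately show ?thesis unfolding within_distance_def by blast
qed

lemma card_arcs_le_edges:
  assumes "finite T" "irrefl T"
  shows "card T \<le> 2 * card ((\<lambda>(u, v). {u, v}) ` T)"
proof -
  let ?e = "\<lambda>(u, v). {u, v}"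
  obtain pick :: "'a set \<Rightarrow> 'a" where pick: "\<And>a b. pick {a, b} \<in> {a, b}"
  proof
    show "(SOME w. w \<in> {a, b}) \<in> {a, b}" for a b :: 'a by (rule someI[of _ a]) simp
  qed
  \<comment> \<open>At most two arcs have the same two ends; the Boolean records which end is the
    tail and makes the map injective.\<close>
  let ?g = "\<lambda>(u, v). ({u, v}, u = pick {u, v})"
  have "inj_on ?g T"
  proof (rule inj_onI)
    fix s t assume st: "s \<in> T" "t \<in> T" "?g s = ?g t"
    obtain a b c d where ab: "s = (a, b)" "t = (c, d)" by (cases s, cases t)
    have "a \<noteq> b" "c \<noteq> d" using st ab assms(2) by (auto simp: irrefl_def)
    moreover have "{a, b} = {c, d}" "(a = pick {a, b}) = (c = pick {c, d})"
      using st(3) unfolding ab prod.case prod.inject by (blast, blast)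
    moreover from this have "(a = pick {c, d}) = (c = pick {c, d})" by simp
    ultimately have "a = c \<and> b = d" using pick[of c d] by (fastforce simp only: doubleton_eq_iff insert_iff empty_iff)
    then show "s = t" using ab by simp
  qed
  moreover have "?g ` T \<subseteq> ?e ` T \<times> UNIV" by auto
  ultimately have "card T \<le> card (?e ` T \<times> (UNIV :: bool set))"
    using assms(1) by (intro card_inj_on_le[of ?g]) auto
  then show ?thesis by (simp add: card_cartesian_product)
qed

text \<open>Every vertex of \<open>X\<close> absorbs the inner vertices of the pairs of
  \<open>T\<close> that leave it. A pair (u, v) is then realised by an edge of its connection that
  enters \<open>v\<close>. Branch sets stay disjoint because the witnesses are disjoint from each
  other and from \<open>X\<close>.\<close>

lemma disjoint_witnesses_shallow_minor:
  assumes H: "simple_graph H" and F: "witnessed H F I L m" and X: "X \<subseteq> verts H"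
    and T: "T \<subseteq> F \<inter> X \<times> X" "disjoint_family_on I T" "\<And>t. t \<in> T \<Longrightarrow> I t \<inter> X = {}"
  shows "shallow_minor (Suc L * Suc L) \<lparr>verts = X, edges = (\<lambda>(u, v). {u, v}) ` T\<rparr> H"
proof -
  have V: "finite (verts H)" using H by (simp add: simple_graph_def)
  define B where "B = (\<lambda>u. insert u (\<Union>v\<in>{v. (u, v) \<in> T}. I (u, v)))"
  have FT: "I (u, v) \<subseteq> verts H" "finite (I (u, v))" "card (I (u, v)) \<le> L"
      "conn (adjacency H) (insert u (I (u, v)))" "conn (adjacency H) (insert u (insert v (I (u, v))))"
      "u \<noteq> v" if "(u, v) \<in> T" for u v
  proof -
    have uv: "(u, v) \<in> F" using T(1) that by blast
    show "I (u, v) \<subseteq> verts H" "card (I (u, v)) \<le> L"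
      "conn (adjacency H) (insert u (I (u, v)))" "conn (adjacency H) (insert u (insert v (I (u, v))))"
      "u \<noteq> v" using witnessedD[OF F] uv by blast+
    then show "finite (I (u, v))" using V finite_subset by blast
  qed
  have BV: "B u \<subseteq> verts H" if "u \<in> X" for u
    using that X FT(1) by (auto simp: B_def)
  have disj: "disjoint_family_on B X"
    unfolding disjoint_family_on_def
  proof (intro ballI impI)
    fix u w assume uw: "u \<in> X" "w \<in> X" "u \<noteq> w"
    have "I (u, v) \<inter> I (w, v') = {}" if "(u, v) \<in> T" "(w, v') \<in> T" for v v'
      using T(2) that uw(3) by (auto simp: disjoint_family_on_def)
    moreover have "w \<notin> I t" "u \<notin> I t" if "t \<in> T" for t using T(3)[OF that] uw by auto
    ultimately show "B u \<inter> B w = {}" using uw(3) by (auto simp: B_def)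
  qed
  have rad: "connected_radius_le (induced_subgraph H (B u)) (Suc L * Suc L)" if u: "u \<in> X" for u
  proof -
    have "within_distance (induced_subgraph H (B u)) (Suc L * Suc L) u z" if z: "z \<in> B u" for z
    proof -
      have "\<exists>S. conn (adjacency H) S \<and> finite S \<and> S \<subseteq> B u \<and> u \<in> S \<and> z \<in> S \<and> card S \<le> Suc L"
      proof (cases "z = u")
        case True
        then show ?thesis by (intro exI[of _ "{u}"]) (auto simp: B_def)
      next
        case False
        then obtain v where v: "(u, v) \<in> T" "z \<in> I (u, v)" using z by (auto simp: B_def)
        then have "card (insert u (I (u, v))) \<le> Suc L"
          using FT(2,3)[OF v(1)] by (simp add: card_insert_if)
        then show ?thesis using v FT(2,4)[OF v(1)]
          by (intro exI[of _ "insert u (I (u, v))"]) (auto simp: B_def)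
      qed
      then obtain S where S: "conn (adjacency H) S" "finite S" "S \<subseteq> B u" "u \<in> S" "z \<in> S" "card S \<le> Suc L"
        by blast
      have "card S * card S \<le> Suc L * Suc L" using S(6) mult_le_mono by blast
      then show ?thesis
        using conn_within_distance[OF S(1-5)] unfolding within_distance_def by (meson order_trans)
    qed
    moreover have "verts (induced_subgraph H (B u)) = B u"
      using BV[OF u] by (auto simp: induced_subgraph_def)
    moreover have "u \<in> B u" by (simp add: B_def)
    ultimately show ?thesis unfolding connected_radius_le_def by auto
  qed
  have touch: "\<exists>x\<in>B u. (x, v) \<in> adjacency H \<and> (v, x) \<in> adjacency H" if uv: "(u, v) \<in> T" for u v
  proof -
    \<comment> \<open>The connection is taken with both ends, which also covers an empty witness:
      the neighbour of \<open>v\<close> is then \<open>u\<close> itself.\<close>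
    obtain z where z: "z \<in> insert u (insert v (I (u, v)))" "(v, z) \<in> adjacency H"
      using conn_neighbour[OF FT(5)[OF uv], of v u] FT(6)[OF uv] by auto
    then have "z \<noteq> v" using adjacency_verts[OF H] by blast
    then have "z \<in> B u" using z uv by (auto simp: B_def)
    then show ?thesis using z(2) symD[OF sym_adjacency z(2)] by blast
  qed
  have "simple_graph \<lparr>verts = X, edges = (\<lambda>(u, v). {u, v}) ` T\<rparr>"
    using T(1) FT(6) finite_subset[OF X V] by (auto simp: simple_graph_def)
  moreover have "\<exists>x\<in>B u. \<exists>y\<in>B v. {x, y} \<in> edges H" if "{u, v} \<in> (\<lambda>(u, v). {u, v}) ` T" for u v
  proof -
    have self: "v \<in> B v" for v by (simp add: B_def)
    have "(u, v) \<in> T \<or> (v, u) \<in> T" using that by (auto simp: doubleton_eq_iff)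
    then show ?thesis using touch self unfolding adjacency_def by blast
  qed
  ultimately show ?thesis
    using disj BV rad unfolding shallow_minor_def by (intro conjI exI[of _ B]) auto
qed

text \<open>A maximal family \<open>T\<close> of pairs inside \<open>X\<close> with disjoint
  witnesses off \<open>X\<close> is a shallow minor, so it has at most 2b|X| pairs. By maximality
  the witness of every other pair meets \<open>X\<close> or a witness of \<open>T\<close>. These are
  at most (1 + 2bL)|X| vertices, each in at most \<open>m\<close> witnesses.\<close>

lemma witnessed_sparse:
  assumes H: "simple_graph H" and F: "witnessed H F I L m"
    and b: "\<And>G. shallow_minor (Suc L * Suc L) G H \<Longrightarrow> card (edges G) \<le> b * card (verts G)"
  shows "sparse_on (2 * b + m * (1 + L * (2 * b))) (verts H) F"
  unfolding sparse_on_def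
proof (intro allI impI)
  fix X assume X: "X \<subseteq> verts H"
  have V: "finite (verts H)" using H by (simp add: simple_graph_def)
  have fF: "finite F" using F V finite_subset[of F "verts H \<times> verts H"] by (simp add: witnessed_def)
  let ?S = "F \<inter> X \<times> X"
  define ok where "ok = (\<lambda>T. T \<subseteq> ?S \<and> disjoint_family_on I T \<and> (\<forall>t\<in>T. I t \<inter> X = {}))"
  have "ok {}" by (simp add: ok_def disjoint_family_on_def)
  moreover have "\<forall>T. ok T \<longrightarrow> card T < Suc (card F)"
    using fF card_mono[OF fF] by (auto simp: ok_def less_Suc_eq_le)
  ultimately obtain T where T: "ok T" "\<And>T'. ok T' \<Longrightarrow> card T' \<le> card T"
    using ex_has_greatest_nat[of ok "{}" card] by blast
  have T': "T \<subseteq> ?S" "disjoint_family_on I T" "\<And>t. t \<in> T \<Longrightarrow> I t \<inter> X = {}"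
    using T(1) by (auto simp: ok_def)
  have fT: "finite T" using T'(1) fF finite_subset by blast
  have "irrefl T" using F T'(1) by (auto simp: witnessed_def irrefl_def)
  have "card ((\<lambda>(u, v). {u, v}) ` T) \<le> b * card X"
    using b[OF disjoint_witnesses_shallow_minor[OF H F X T']] by simp
  then have cT: "card T \<le> 2 * b * card X" using card_arcs_le_edges[OF fT \<open>irrefl T\<close>] by simp
  let ?Z = "X \<union> (\<Union>t\<in>T. I t)"
  have fI: "finite (I t)" "card (I t) \<le> L" if "t \<in> F" for t
    using witnessedD(4,5)[OF F that] V finite_subset[of "I t" "verts H"] by auto
  have fX: "finite X" using X V finite_subset by blast
  have fZ: "finite ?Z" using fT fX fI T'(1) by auto
  have "card ?Z \<le> card X + (\<Sum>t\<in>T. card (I t))"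
    using card_Un_le[of X "\<Union>t\<in>T. I t"] card_UN_le[OF fT, of I] by linarith
  also have "(\<Sum>t\<in>T. card (I t)) \<le> (\<Sum>t\<in>T. L)"
    using fI T'(1) by (intro sum_mono) auto
  also have "\<dots> = card T * L" by simp
  also have "\<dots> \<le> 2 * b * card X * L" using cT by simp
  finally have cZ: "card ?Z \<le> (1 + L * (2 * b)) * card X" by (simp add: algebra_simps)
  have "?S \<subseteq> T \<union> (\<Union>z\<in>?Z. {e \<in> F. z \<in> I e})"
  proof
    fix s assume s: "s \<in> ?S"
    show "s \<in> T \<union> (\<Union>z\<in>?Z. {e \<in> F. z \<in> I e})"
    proof (cases "s \<in> T \<or> I s \<inter> ?Z \<noteq> {}")
      case True
      then show ?thesis using s by auto
    next
      case False
      then have "ok (insert s T)"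
        using T(1) s by (auto simp: ok_def disjoint_family_on_def)
      then have "card (insert s T) \<le> card T" using T(2) by blast
      then show ?thesis using False fT by simp
    qed
  qed
  then have "card ?S \<le> card (T \<union> (\<Union>z\<in>?Z. {e \<in> F. z \<in> I e}))"
    using fT fZ fF by (intro card_mono) auto
  also have "\<dots> \<le> card T + (\<Sum>z\<in>?Z. card {e \<in> F. z \<in> I e})"
    using card_Un_le[of T "\<Union>z\<in>?Z. {e \<in> F. z \<in> I e}"] card_UN_le[OF fZ, of "\<lambda>z. {e \<in> F. z \<in> I e}"]
    by linarith
  also have "(\<Sum>z\<in>?Z. card {e \<in> F. z \<in> I e}) \<le> (\<Sum>z\<in>?Z. m)"
    using witnessedD(3)[OF F] by (intro sum_mono)
  also have "\<dots> \<le> (1 + L * (2 * b)) * card X * m" using cZ by simp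
  finally have "card ?S \<le> 2 * b * card X + (1 + L * (2 * b)) * card X * m" using cT by linarith
  then show "card ?S \<le> (2 * b + m * (1 + L * (2 * b))) * card X" by (simp add: algebra_simps)
qed

subsection \<open>Fraternal augmentations\<close>

text \<open>Only tails with a common head have to be joined. No transitive arcs are asked for,
  because directed walks are handled through powers of the relation.\<close>

definition fraternal :: "('a \<times> 'a) set \<Rightarrow> ('a \<times> 'a) set \<Rightarrow> bool" where
  "fraternal A A' \<longleftrightarrow> A \<subseteq> A' \<and>
     (\<forall>u v x. (u, x) \<in> A \<longrightarrow> (v, x) \<in> A \<longrightarrow> u \<noteq> v \<longrightarrow> (u, v) \<in> A' \<or> (v, u) \<in> A')"

text \<open>Finiteness is demanded separately since \<open>card\<close> of an infinite set is
  0.\<close>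

definition indegree_le :: "('a \<times> 'a) set \<Rightarrow> nat \<Rightarrow> bool" where
  "indegree_le A D \<longleftrightarrow> (\<forall>x. finite {u. (u, x) \<in> A} \<and> card {u. (u, x) \<in> A} \<le> D)"

lemma indegree_leI:
  assumes "A \<subseteq> V \<times> V" "finite V" "\<And>x. card {u. (u, x) \<in> A} \<le> D"
  shows "indegree_le A D"
proof -
  have "finite {u. (u, x) \<in> A}" for x
    by (rule finite_subset[OF _ assms(2)]) (use assms(1) in auto)
  then show ?thesis using assms(3) by (simp add: indegree_le_def)
qed

lemma indegree_le_Un:
  assumes "indegree_le A D" "indegree_le B D'"
  shows "indegree_le (A \<union> B) (D + D')"
proof -
  have "{u. (u, x) \<in> A \<union> B} = {u. (u, x) \<in> A} \<union> {u. (u, x) \<in> B}" for x by auto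
  then show ?thesis
    using assms card_Un_le add_mono order_trans unfolding indegree_le_def
    by (metis (no_types, lifting) finite_UnI)
qed

lemma indegree_le_relpow:
  assumes R: "indegree_le R D"
  shows "finite {u. (u, v) \<in> R ^^ k} \<and> card {u. (u, v) \<in> R ^^ k} \<le> D ^ k"
proof (induction k arbitrary: v)
  case 0
  have "{u. u = v} = {v}" by auto
  then show ?case by simp
next
  case (Suc k)
  let ?N = "{w. (w, v) \<in> R}"
  have N: "finite ?N" "card ?N \<le> D" using R by (auto simp: indegree_le_def)
  have eq: "{u. (u, v) \<in> R ^^ Suc k} = (\<Union>w\<in>?N. {u. (u, w) \<in> R ^^ k})" by auto
  have "card (\<Union>w\<in>?N. {u. (u, w) \<in> R ^^ k}) \<le> (\<Sum>w\<in>?N. card {u. (u, w) \<in> R ^^ k})"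
    using N by (intro card_UN_le)
  also have "\<dots> \<le> (\<Sum>w\<in>?N. D ^ k)" using Suc.IH by (intro sum_mono) blast
  also have "\<dots> \<le> D ^ Suc k" using N(2) by simp
  finally show ?case unfolding eq using N Suc.IH by blast
qed

text \<open>The witness of a pair is a common head together with the witnesses of the two arcs into
  it. A vertex \<open>z\<close> lies in it in two ways. If \<open>z\<close> is the common head,
  there are at most D * D pairs. If \<open>z\<close> lies in the witness of one of the two arcs,
  there are at most \<open>m\<close> such arcs, \<open>D\<close> choices for the other tail, and two
  orders.\<close>

lemma fraternal_pairs_witnessed:
  assumes V: "finite (verts H)" and W: "witnessed H A I L m" and D: "indegree_le A D"
  defines "F \<equiv> {(u, v). u \<noteq> v \<and> (\<exists>x. (u, x) \<in> A \<and> (v, x) \<in> A)}"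
  obtains J where "witnessed H F J (Suc (2 * L)) (D * D + 2 * m * D)"
proof -
  define mid where "mid = (\<lambda>(u, v). SOME x. (u, x) \<in> A \<and> (v, x) \<in> A)"
  have mid: "(u, mid (u, v)) \<in> A" "(v, mid (u, v)) \<in> A" if "(u, v) \<in> F" for u v
    using someI_ex[of "\<lambda>x. (u, x) \<in> A \<and> (v, x) \<in> A"] that by (auto simp: mid_def F_def)
  define J where "J = (\<lambda>(u, v). insert (mid (u, v)) (I (u, mid (u, v)) \<union> I (v, mid (u, v))))"
  have AV: "A \<subseteq> verts H \<times> verts H" using witnessedD(1)[OF W] .
  have fA: "finite A" using AV V finite_subset by (metis finite_SigmaI)
  have In: "finite {u. (u, x) \<in> A}" "card {u. (u, x) \<in> A} \<le> D" for x
    using D by (auto simp: indegree_le_def)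
  have "F \<subseteq> verts H \<times> verts H" using AV by (auto simp: F_def)
  moreover have "irrefl F" by (auto simp: F_def irrefl_def)
  moreover have "J (u, v) \<subseteq> verts H" "card (J (u, v)) \<le> Suc (2 * L)"
      "conn (adjacency H) (insert u (J (u, v)))" "conn (adjacency H) (insert v (J (u, v)))"
      "conn (adjacency H) (insert u (insert v (J (u, v))))" if uv: "(u, v) \<in> F" for u v
  proof -
    let ?x = "mid (u, v)"
    let ?a = "I (u, ?x)" and ?b = "I (v, ?x)"
    have J: "J (u, v) = insert ?x (?a \<union> ?b)" by (simp add: J_def)
    show "J (u, v) \<subseteq> verts H" using witnessedD(4)[OF W] mid[OF uv] AV unfolding J by blast
    have "card ?a \<le> L" "card ?b \<le> L" using witnessedD(5)[OF W] mid[OF uv] by blast+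
    moreover have "card (J (u, v)) \<le> Suc (card (?a \<union> ?b))" unfolding J by (rule card_insert_le_m1) auto
    ultimately show "card (J (u, v)) \<le> Suc (2 * L)" using card_Un_le[of ?a ?b] by linarith
    have ca: "conn (adjacency H) (insert ?x ?a)" "conn (adjacency H) (insert u (insert ?x ?a))"
      and cb: "conn (adjacency H) (insert ?x ?b)" "conn (adjacency H) (insert v (insert ?x ?b))"
      using witnessedD(8,9)[OF W] mid[OF uv] by blast+
    have "insert u (J (u, v)) = insert u (insert ?x ?a) \<union> insert ?x ?b"
      "insert v (J (u, v)) = insert ?x ?a \<union> insert v (insert ?x ?b)"
      "insert u (insert v (J (u, v))) = insert u (insert ?x ?a) \<union> insert v (insert ?x ?b)"
      unfolding J by auto
    then show "conn (adjacency H) (insert u (J (u, v)))" "conn (adjacency H) (insert v (J (u, v)))"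
      "conn (adjacency H) (insert u (insert v (J (u, v))))"
      using conn_Un[OF ca(2) cb(1), of ?x] conn_Un[OF ca(1) cb(2), of ?x] conn_Un[OF ca(2) cb(2), of ?x]
      by simp_all
  qed
  moreover have "card {e \<in> F. z \<in> J e} \<le> D * D + 2 * m * D" for z
  proof -
    let ?N = "\<lambda>x. {u. (u, x) \<in> A}" and ?Z = "{e \<in> A. z \<in> I e}"
    let ?A1 = "?N z \<times> ?N z" and ?A2 = "SIGMA a:?Z. ?N (snd a)"
    let ?f = "\<lambda>(a, w). (fst a, w)" and ?g = "\<lambda>(a, w). (w, fst a)"
    have Z: "finite ?Z" "card ?Z \<le> m" using fA witnessedD(3)[OF W] by auto
    have "card ?A2 = (\<Sum>a\<in>?Z. card (?N (snd a)))" using Z In by simp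
    also have "\<dots> \<le> (\<Sum>a\<in>?Z. D)" using In by (intro sum_mono) auto
    also have "\<dots> \<le> m * D" using Z by simp
    finally have A2: "card ?A2 \<le> m * D" .
    have fA2: "finite ?A2" using Z In by auto
    have A1: "card ?A1 \<le> D * D" using In by (simp add: card_cartesian_product mult_le_mono)
    have "{e \<in> F. z \<in> J e} \<subseteq> ?A1 \<union> (?f ` ?A2 \<union> ?g ` ?A2)"
    proof
      fix e assume e: "e \<in> {e \<in> F. z \<in> J e}"
      obtain u v where uv: "e = (u, v)" by (cases e)
      have uvF: "(u, v) \<in> F" using e uv by auto
      let ?x = "mid (u, v)"
      from e uv consider "z = ?x" | "z \<in> I (u, ?x)" | "z \<in> I (v, ?x)" by (auto simp: J_def)
      then show "e \<in> ?A1 \<union> (?f ` ?A2 \<union> ?g ` ?A2)"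
      proof cases
        case 1
        then show ?thesis using mid[OF uvF] uv by auto
      next
        case 2
        then have "((u, ?x), v) \<in> ?A2" using mid[OF uvF] by auto
        then have "?f ((u, ?x), v) \<in> ?f ` ?A2" by (rule imageI)
        then show ?thesis using uv by simp
      next
        case 3
        then have "((v, ?x), u) \<in> ?A2" using mid[OF uvF] by auto
        then have "?g ((v, ?x), u) \<in> ?g ` ?A2" by (rule imageI)
        then show ?thesis using uv by simp
      qed
    qed
    then have "card {e \<in> F. z \<in> J e} \<le> card (?A1 \<union> (?f ` ?A2 \<union> ?g ` ?A2))"
      using fA2 In by (intro card_mono) auto
    also have "\<dots> \<le> card ?A1 + (card (?f ` ?A2) + card (?g ` ?A2))"
      using card_Un_le[of ?A1 "?f ` ?A2 \<union> ?g ` ?A2"] card_Un_le[of "?f ` ?A2" "?g ` ?A2"] by linarith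
    also have "\<dots> \<le> D * D + (m * D + m * D)"
      using A1 A2 card_image_le[OF fA2, of ?f] card_image_le[OF fA2, of ?g] by linarith
    finally show ?thesis by (simp add: algebra_simps)
  qed
  ultimately have "witnessed H F J (Suc (2 * L)) (D * D + 2 * m * D)"
    unfolding witnessed_def by (intro conjI allI impI)
  then show thesis using that by blast
qed

lemma witnessed_subset:
  assumes "witnessed H F I L m" "A \<subseteq> F" "finite F"
  shows "witnessed H A I L m"
proof -
  have "card {e \<in> A. z \<in> I e} \<le> m" for z
    using card_mono[of "{e \<in> F. z \<in> I e}" "{e \<in> A. z \<in> I e}"] assms witnessedD(3)[OF assms(1), of z]
    by (auto intro: order_trans)
  then show ?thesis using assms unfolding witnessed_def irrefl_def by blast
qed

lemma witnessed_Un: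
  assumes A: "witnessed H A I L m" and B: "witnessed H B J L' m'" and fin: "finite A" "finite B"
    and L: "L \<le> L'"
  shows "witnessed H (A \<union> B) (\<lambda>e. if e \<in> A then I e else J e) L' (m + m')"
proof -
  have "card {e \<in> A \<union> B. z \<in> (if e \<in> A then I e else J e)} \<le> m + m'" for z
  proof -
    have "{e \<in> A \<union> B. z \<in> (if e \<in> A then I e else J e)} \<subseteq> {e \<in> A. z \<in> I e} \<union> {e \<in> B. z \<in> J e}" by auto
    then have "card {e \<in> A \<union> B. z \<in> (if e \<in> A then I e else J e)} \<le> card ({e \<in> A. z \<in> I e} \<union> {e \<in> B. z \<in> J e})"
      using fin by (intro card_mono) auto
    then show ?thesis
      using card_Un_le[of "{e \<in> A. z \<in> I e}" "{e \<in> B. z \<in> J e}"] witnessedD(3)[OF A, of z]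
        witnessedD(3)[OF B, of z] by linarith
  qed
  moreover have "card (I e) \<le> L'" if "e \<in> A" for e
    using witnessedD(5)[OF A that] L by linarith
  ultimately show ?thesis
    using witnessedD(1,2,4,7-9)[OF A] witnessedD(1,2,4,5,7-9)[OF B] unfolding witnessed_def irrefl_def
    by auto
qed

definition augmented :: "'a sgraph \<Rightarrow> ('a \<times> 'a) set \<Rightarrow> nat \<Rightarrow> nat \<Rightarrow> nat \<Rightarrow> bool" where
  "augmented H A D L m \<longleftrightarrow> (\<exists>I. witnessed H A I L m) \<and> indegree_le A D"

text \<open>The fraternal pairs are sparse by \<open>witnessed_sparse\<close>, so they can be
  oriented with bounded indegree and added to \<open>A\<close>. Old arcs keep their witnesses, and
  the bounds for old and new arcs add up.\<close>

lemma fraternal_augmentation: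
  assumes H: "simple_graph H" and A: "augmented H A D L m"
    and b: "\<And>G. shallow_minor (Suc (Suc (2 * L)) * Suc (Suc (2 * L))) G H \<Longrightarrow> card (edges G) \<le> b * card (verts G)"
  shows "\<exists>A'. fraternal A A' \<and>
    augmented H A' (D + (2 * b + (D * D + 2 * m * D) * (1 + Suc (2 * L) * (2 * b)))) (Suc (2 * L))
      (m + (D * D + 2 * m * D))"
proof -
  have V: "finite (verts H)" using H by (simp add: simple_graph_def)
  obtain I where W: "witnessed H A I L m" and D: "indegree_le A D"
    using A by (auto simp: augmented_def)
  define F where "F = {(u, v). u \<noteq> v \<and> (\<exists>x. (u, x) \<in> A \<and> (v, x) \<in> A)}"
  obtain J where J: "witnessed H F J (Suc (2 * L)) (D * D + 2 * m * D)"
    using fraternal_pairs_witnessed[OF V W D] unfolding F_def by blast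
  have FV: "F \<subseteq> verts H \<times> verts H" "A \<subseteq> verts H \<times> verts H" using witnessedD(1) J W by blast+
  then have fin: "finite F" "finite A" using V finite_subset by (metis finite_SigmaI)+
  let ?c = "2 * b + (D * D + 2 * m * D) * (1 + Suc (2 * L) * (2 * b))"
  have "sym F" by (auto simp: F_def sym_def)
  then obtain B where B: "B \<subseteq> F" "F \<subseteq> B \<union> B\<inverse>" "\<And>v. card {u. (u, v) \<in> B} \<le> ?c"
    using sparse_orientation[OF V witnessed_sparse[OF H J b] FV(1)] by auto
  have fB: "finite B" using B(1) fin finite_subset by blast
  have "fraternal A (A \<union> B)" using B(2) unfolding fraternal_def F_def by blast
  moreover have "indegree_le B ?c"
    using B(1,3) FV(1) V by (intro indegree_leI[of _ "verts H"]) auto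
  then have "indegree_le (A \<union> B) (D + ?c)" using D by (rule indegree_le_Un[rotated])
  moreover have "witnessed H (A \<union> B) (\<lambda>e. if e \<in> A then I e else J e) (Suc (2 * L)) (m + (D * D + 2 * m * D))"
    using fin fB by (intro witnessed_Un[OF W witnessed_subset[OF J B(1)]]) auto
  ultimately show ?thesis unfolding augmented_def by blast
qed

lemma adjacency_witnessed:
  assumes "simple_graph H"
  shows "witnessed H (adjacency H) (\<lambda>_. {}) 0 0"
  unfolding witnessed_def
proof (intro conjI allI impI)
  show "adjacency H \<subseteq> verts H \<times> verts H" "irrefl (adjacency H)"
    using adjacency_verts[OF assms] by (force simp: irrefl_def)+
  show "conn (adjacency H) (insert u (insert v {}))" if "(u, v) \<in> adjacency H" for u v
    using conn_edge[OF sym_adjacency that] .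
qed auto

definition sparse_minors :: "'a sgraph set \<Rightarrow> bool" where
  "sparse_minors C \<longleftrightarrow> (\<forall>H\<in>C. simple_graph H) \<and>
     (\<forall>d. \<exists>b::nat. \<forall>H\<in>C. \<forall>G. shallow_minor d G H \<longrightarrow> card (edges G) \<le> b * card (verts G))"

lemma bounded_expansion_sparse_minors:
  assumes "bounded_expansion C"
  shows "sparse_minors C"
  unfolding sparse_minors_def
proof (intro conjI allI)
  show "\<forall>H\<in>C. simple_graph H" using assms by (simp add: bounded_expansion_def)
  fix d
  obtain a :: real where a: "\<And>H G. H \<in> C \<Longrightarrow> shallow_minor d G H \<Longrightarrow>
      real (card (edges G)) \<le> a * real (card (verts G))"
    using assms unfolding bounded_expansion_def by meson
  \<comment> \<open>For negative \<open>a\<close> the factor is 0, which still bounds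
    \<open>a\<close> from above.\<close>
  have "card (edges G) \<le> nat \<lceil>a\<rceil> * card (verts G)" if "H \<in> C" "shallow_minor d G H" for H G
  proof -
    have "a * real (card (verts G)) \<le> real (nat \<lceil>a\<rceil>) * real (card (verts G))"
      by (intro mult_right_mono) linarith+
    then have "real (card (edges G)) \<le> real (nat \<lceil>a\<rceil> * card (verts G))" using a[OF that] by simp
    then show ?thesis by (simp only: of_nat_le_iff)
  qed
  then show "\<exists>b::nat. \<forall>H\<in>C. \<forall>G. shallow_minor d G H \<longrightarrow> card (edges G) \<le> b * card (verts G)"
    by blast
qed

definition augmentation_chain :: "'a sgraph \<Rightarrow> nat \<Rightarrow> (nat \<Rightarrow> ('a \<times> 'a) set) \<Rightarrow> bool" where
  "augmentation_chain H n A \<longleftrightarrow> A 0 \<subseteq> adjacency H \<and> adjacency H \<subseteq> A 0 \<union> (A 0)\<inverse> \<and>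
     (\<forall>i<n. fraternal (A i) (A (Suc i)))"

text \<open>The order of choices matters: the density \<open>b\<close> used in the next step depends
  on the witness size \<open>L\<close> reached so far, but is fixed before the graph
  \<open>H\<close> is.\<close>

lemma augmentation_chain_exists:
  assumes C: "sparse_minors C"
  shows "\<exists>D L m. \<forall>H\<in>C. \<exists>A. augmentation_chain H n A \<and> augmented H (A n) D L m"
proof (induction n)
  case 0
  obtain b where b: "\<And>H G. H \<in> C \<Longrightarrow> shallow_minor (Suc 0 * Suc 0) G H \<Longrightarrow> card (edges G) \<le> b * card (verts G)"
    using C unfolding sparse_minors_def by meson
  \<comment> \<open>The constant is that of \<open>witnessed_sparse\<close> for L = m = 0: an edge
    is a connection without inner vertices.\<close>
  have "\<exists>A. augmentation_chain H 0 A \<and> augmented H (A 0) (2 * b + 0 * (1 + 0 * (2 * b))) 0 0" if H: "H \<in> C" for H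
  proof -
    have sH: "simple_graph H" using C H by (simp add: sparse_minors_def)
    then have V: "finite (verts H)" by (simp add: simple_graph_def)
    note W = adjacency_witnessed[OF sH]
    have E: "adjacency H \<subseteq> verts H \<times> verts H" using witnessedD(1)[OF W] .
    obtain A where A: "A \<subseteq> adjacency H" "adjacency H \<subseteq> A \<union> A\<inverse>"
        "\<And>v. card {u. (u, v) \<in> A} \<le> 2 * b + 0 * (1 + 0 * (2 * b))"
      using sparse_orientation[OF V witnessed_sparse[OF sH W b[OF H]] E sym_adjacency] by blast
    have "indegree_le A (2 * b + 0 * (1 + 0 * (2 * b)))"
      using A(1,3) E V by (intro indegree_leI[of _ "verts H"]) auto
    moreover have "witnessed H A (\<lambda>_. {}) 0 0"
      using witnessed_subset[OF W A(1)] E V finite_subset by (metis finite_SigmaI)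
    ultimately show ?thesis using A(1,2)
      by (intro exI[of _ "\<lambda>_. A"]) (auto simp: augmentation_chain_def augmented_def)
  qed
  then show ?case by blast
next
  case (Suc n)
  then obtain D L m where IH: "\<And>H. H \<in> C \<Longrightarrow> \<exists>A. augmentation_chain H n A \<and> augmented H (A n) D L m"
    by blast
  obtain b where b: "\<And>H G. H \<in> C \<Longrightarrow> shallow_minor (Suc (Suc (2 * L)) * Suc (Suc (2 * L))) G H \<Longrightarrow>
      card (edges G) \<le> b * card (verts G)"
    using C unfolding sparse_minors_def by meson
  let ?D = "D + (2 * b + (D * D + 2 * m * D) * (1 + Suc (2 * L) * (2 * b)))"
    and ?L = "Suc (2 * L)" and ?m = "m + (D * D + 2 * m * D)"
  have "\<exists>A. augmentation_chain H (Suc n) A \<and> augmented H (A (Suc n)) ?D ?L ?m" if H: "H \<in> C" for H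
  proof -
    have sH: "simple_graph H" using C H by (simp add: sparse_minors_def)
    obtain A where A: "augmentation_chain H n A" "augmented H (A n) D L m" using IH[OF H] by blast
    obtain A' where A': "fraternal (A n) A'" "augmented H A' ?D ?L ?m"
      using fraternal_augmentation[OF sH A(2) b[OF H]] by blast
    have "augmentation_chain H (Suc n) (A(Suc n := A'))"
      using A(1) A'(1) by (auto simp: augmentation_chain_def less_Suc_eq)
    then show ?thesis using A'(2) by (intro exI[of _ "A(Suc n := A')"]) simp
  qed
  then show ?case by blast
qed

lemma augmentation_chain_mono:
  assumes "augmentation_chain H n A" "i \<le> j" "j \<le> n"
  shows "A i \<subseteq> A j"
  using assms(2,3)
proof (induction j)
  case (Suc j)
  show ?case
  proof (cases "i = Suc j")
    case False
    then have "A i \<subseteq> A j" using Suc by simp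
    moreover have "A j \<subseteq> A (Suc j)" using assms(1) Suc.prems by (simp add: augmentation_chain_def fraternal_def)
    ultimately show ?thesis by blast
  qed simp
qed simp

text \<open>Where the two walks meet, the last arcs come from two vertices that the next augmentation
  joins by an arc; this shortens the configuration.\<close>

lemma meeting_walks_collapse:
  assumes chain: "augmentation_chain H n A"
  shows "i + s + t \<le> n \<Longrightarrow> (u, x) \<in> A i ^^ s \<Longrightarrow> (v, x) \<in> A i ^^ t \<Longrightarrow>
    \<exists>k\<le>s + t. (u, v) \<in> A n ^^ k \<or> (v, u) \<in> A n ^^ k"
proof (induction "s + t" arbitrary: i s t x rule: less_induct)
  case less
  have up: "(a, b) \<in> A i ^^ k \<Longrightarrow> (a, b) \<in> A j ^^ k" if "i \<le> j" "j \<le> n" for a b k j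
    using relpow_mono[OF augmentation_chain_mono[OF chain that]] by blast
  show ?case
  proof (cases "s = 0 \<or> t = 0")
    case True
    then show ?thesis using less.prems up[of n] by force
  next
    case False
    then obtain s' t' where st: "s = Suc s'" "t = Suc t'" by (metis not0_implies_Suc)
    obtain a where a: "(u, a) \<in> A i ^^ s'" "(a, x) \<in> A i" using less.prems(2) st by auto
    obtain b where b: "(v, b) \<in> A i ^^ t'" "(b, x) \<in> A i" using less.prems(3) st by auto
    show ?thesis
    proof (cases "a = b")
      \<comment> \<open>The walks already meet one step earlier; the total length drops by two
        without using an augmentation.\<close>
      case True
      then have "\<exists>k\<le>s' + t'. (u, v) \<in> A n ^^ k \<or> (v, u) \<in> A n ^^ k"
        using less.hyps[of s' t' i a] a b st less.prems(1) by simp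
      then show ?thesis using st by (meson add_le_mono le_SucI order_trans order_refl)
    next
      case False
      have "fraternal (A i) (A (Suc i))"
        using chain less.prems(1) st by (simp add: augmentation_chain_def)
      then consider "(a, b) \<in> A (Suc i)" | "(b, a) \<in> A (Suc i)"
        using a(2) b(2) False unfolding fraternal_def by blast
      then show ?thesis
      proof cases
        \<comment> \<open>The new arc carries the first walk on to \<open>b\<close>, so its length
          is again \<open>s\<close>, while the other one loses its last arc. The index rises by one,
          so the sum i + s + t that \<open>n\<close> bounds is unchanged.\<close>
        case 1
        then have "(u, b) \<in> A (Suc i) ^^ s" using up[of "Suc i"] a(1) st less.prems(1) by auto
        moreover have "(v, b) \<in> A (Suc i) ^^ t'" using up[of "Suc i"] b(1) st less.prems(1) by auto
        ultimately have "\<exists>k\<le>s + t'. (u, v) \<in> A n ^^ k \<or> (v, u) \<in> A n ^^ k"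
          using less.hyps[of s t' "Suc i" b] st less.prems(1) by simp
        then show ?thesis using st by (metis add_Suc_right le_SucI)
      next
        case 2
        then have "(v, a) \<in> A (Suc i) ^^ t" using up[of "Suc i"] b(1) st less.prems(1) by auto
        moreover have "(u, a) \<in> A (Suc i) ^^ s'" using up[of "Suc i"] a(1) st less.prems(1) by auto
        ultimately have "\<exists>k\<le>s' + t. (u, v) \<in> A n ^^ k \<or> (v, u) \<in> A n ^^ k"
          using less.hyps[of s' t "Suc i" a] st less.prems(1) by simp
        then show ?thesis using st by (metis add_Suc le_SucI)
      qed
    qed
  qed
qed

text \<open>Pairs are counted at the end of the walk, where at most D ^ k starting points of walks
  of length k are possible; the factor 2 accounts for the two directions.\<close>

lemma bounded_walks_sparse:
  assumes R: "indegree_le R D"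
  shows "sparse_on (2 * (\<Sum>k\<le>n. D ^ k)) V {(u, v). \<exists>k\<le>n. (u, v) \<in> R ^^ k \<or> (v, u) \<in> R ^^ k}"
  unfolding sparse_on_def
proof (intro allI impI)
  fix X assume "X \<subseteq> V"
  let ?Q = "{(u, v). \<exists>k\<le>n. (u, v) \<in> R ^^ k \<or> (v, u) \<in> R ^^ k} \<inter> X \<times> X"
  let ?c = "\<Sum>k\<le>n. D ^ k"
  show "card ?Q \<le> 2 * ?c * card X"
  proof (cases "finite X")
    \<comment> \<open>For infinite \<open>X\<close> the right side is 0. Walks of length 0 put the
      diagonal into \<open>?Q\<close>, so \<open>?Q\<close> is infinite and its \<open>card\<close>
      is 0 as well.\<close>
    case False
    show ?thesis
    proof (cases "finite ?Q")
      case True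
      have "(\<lambda>x. (x, x)) ` X \<subseteq> ?Q" by (auto intro: exI[of _ 0])
      then have "finite ((\<lambda>x. (x, x)) ` X)" using True finite_subset by blast
      then have "finite X" by (rule finite_imageD) (simp add: inj_on_def)
      then show ?thesis using False by simp
    qed simp
  next
    case True
    let ?N = "\<lambda>v. \<Union>k\<in>{..n}. {u. (u, v) \<in> R ^^ k}"
    have fN: "finite (?N v)" for v using indegree_le_relpow[OF R] by blast
    have N: "card (?N v) \<le> ?c" for v
    proof -
      have "card (?N v) \<le> (\<Sum>k\<le>n. card {u. (u, v) \<in> R ^^ k})" by (rule card_UN_le) simp
      also have "\<dots> \<le> ?c" using indegree_le_relpow[OF R] by (intro sum_mono) blast
      finally show ?thesis .
    qed
    let ?S = "SIGMA v:X. ?N v"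
    have fS: "finite ?S" using True fN by blast
    have "card ?S = (\<Sum>v\<in>X. card (?N v))" using True fN by (intro card_SigmaI) auto
    also have "\<dots> \<le> (\<Sum>v\<in>X. ?c)" using N by (intro sum_mono)
    finally have S: "card ?S \<le> ?c * card X" by (simp add: mult.commute)
    have "?Q \<subseteq> prod.swap ` ?S \<union> ?S" by (force simp: image_iff)
    then have "card ?Q \<le> card (prod.swap ` ?S \<union> ?S)" using fS by (intro card_mono) auto
    also have "\<dots> \<le> card ?S + card ?S"
      using card_Un_le[of "prod.swap ` ?S" ?S] card_image_le[OF fS, of prod.swap] by linarith
    finally show ?thesis using S by (simp add: algebra_simps)
  qed
qed

text \<open>Six augmentations turn two meeting walks of length at most 3 into one walk of length at
  most 6 between their starting points. A proper colouring of that sparse relation gives different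
  colours to distinct starting points.\<close>

lemma separating_colouring:
  assumes C: "sparse_minors C"
  shows "\<exists>c. \<forall>H\<in>C. \<exists>A f. A \<subseteq> adjacency H \<and> adjacency H \<subseteq> A \<union> A\<inverse> \<and> (\<forall>v\<in>verts H. f v \<le> (c::nat)) \<and>
    (\<forall>s\<le>3. \<forall>t\<le>3. \<forall>u\<in>verts H. \<forall>v\<in>verts H. \<forall>x. (u, x) \<in> A ^^ s \<longrightarrow> (v, x) \<in> A ^^ t \<longrightarrow> f u = f v \<longrightarrow> u = v)"
proof -
  obtain D L m where chain: "\<And>H. H \<in> C \<Longrightarrow> \<exists>A. augmentation_chain H 6 A \<and> augmented H (A 6) D L m"
    using augmentation_chain_exists[OF C, of 6] by blast
  let ?c = "2 * (\<Sum>k\<le>6. D ^ k)"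
  have "\<exists>A f. A \<subseteq> adjacency H \<and> adjacency H \<subseteq> A \<union> A\<inverse> \<and> (\<forall>v\<in>verts H. f v \<le> ?c) \<and>
    (\<forall>s\<le>3. \<forall>t\<le>3. \<forall>u\<in>verts H. \<forall>v\<in>verts H. \<forall>x. (u, x) \<in> A ^^ s \<longrightarrow> (v, x) \<in> A ^^ t \<longrightarrow> f u = f v \<longrightarrow> u = v)"
    if H: "H \<in> C" for H
  proof -
    have V: "finite (verts H)" using C H by (simp add: sparse_minors_def simple_graph_def)
    obtain A where A: "augmentation_chain H 6 A" "augmented H (A 6) D L m" using chain[OF H] by blast
    let ?Q = "{(u, v). \<exists>k\<le>6. (u, v) \<in> A 6 ^^ k \<or> (v, u) \<in> A 6 ^^ k}"
    have "sym ?Q" by (auto simp: sym_def)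
    have ind: "indegree_le (A 6) D" using A(2) by (simp add: augmented_def)
    obtain f where f: "(\<forall>v\<in>verts H. f v \<le> ?c) \<and>
        (\<forall>u\<in>verts H. \<forall>v\<in>verts H. u \<noteq> v \<and> (u, v) \<in> ?Q \<longrightarrow> f u \<noteq> f v)"
      using sparse_colouring[OF V bounded_walks_sparse[OF ind] \<open>sym ?Q\<close>] by (rule exE)
    have "u = v" if "s \<le> 3" "t \<le> 3" "u \<in> verts H" "v \<in> verts H" "(u, x) \<in> A 0 ^^ s" "(v, x) \<in> A 0 ^^ t" "f u = f v"
      for s t u v x
    proof -
      have "\<exists>k\<le>s + t. (u, v) \<in> A 6 ^^ k \<or> (v, u) \<in> A 6 ^^ k"
        using meeting_walks_collapse[OF A(1), of 0 s t u x v] that by simp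
      then obtain k where "k \<le> s + t" "(u, v) \<in> A 6 ^^ k \<or> (v, u) \<in> A 6 ^^ k" by blast
      then have "(u, v) \<in> ?Q" using that(1,2) by (auto intro: exI[of _ k])
      then show ?thesis using f that(3,4,7) by meson
    qed
    then show ?thesis
      using A(1) f unfolding augmentation_chain_def
      by (intro exI[of _ "A 0"] exI[of _ f] conjI allI ballI impI) simp_all
  qed
  then show ?thesis by (intro exI[of _ ?c]) blast
qed

subsection \<open>Labels for a separating colouring\<close>

text \<open>One prime per index and the Chinese remainder theorem: modulo the prime of
  \<open>\<tau>\<close> the label is the indicator of \<open>T \<tau>\<close>, so a sum of labels
  counts points. The bound \<open>l\<close> is fixed before the sets \<open>T\<close> are given, as
  it depends on the index set only.\<close>

lemma residue_labels:
  fixes \<Theta> :: "'b::countable set"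
  assumes "finite \<Theta>"
  obtains l :: nat where "\<And>T :: 'b \<Rightarrow> 'a set. \<exists>f. (\<forall>x. f x \<in> {1..l}) \<and>
    (\<forall>\<tau>\<in>\<Theta>. \<forall>S S'. finite S \<longrightarrow> finite S' \<longrightarrow> card (T \<tau> \<inter> S) \<le> 2 \<longrightarrow> card (T \<tau> \<inter> S') \<le> 2 \<longrightarrow>
      sum f S = sum f S' \<longrightarrow> card (T \<tau> \<inter> S) = card (T \<tau> \<inter> S'))"
proof -
  \<comment> \<open>The prime 2 is left out because the counts 0, 1 and 2 must have distinct
    residues.\<close>
  have "infinite ({p::nat. prime p} - {..2})" using primes_infinite by (intro Diff_infinite_finite) auto
  then obtain q :: "nat \<Rightarrow> nat" where q: "inj q" "range q \<subseteq> {p. prime p} - {..2}"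
    using infinite_countable_subset by blast
  define m where "m = (\<lambda>\<tau>::'b. q (to_nat \<tau>))"
  have m: "prime (m \<tau>)" "2 < m \<tau>" for \<tau>
    using subsetD[OF q(2) rangeI, of "to_nat \<tau>"] by (auto simp: m_def)
  have inj: "m \<tau> \<noteq> m \<tau>'" if "\<tau> \<noteq> \<tau>'" for \<tau> \<tau>'
    using that injD[OF q(1), of "to_nat \<tau>" "to_nat \<tau>'"] injD[OF inj_to_nat, of \<tau> \<tau>'] by (auto simp: m_def)
  have cop: "coprime (m \<tau>) (m \<tau>')" if "\<tau> \<noteq> \<tau>'" for \<tau> \<tau>'
    using primes_coprime[OF m(1) m(1) inj[OF that]] .
  define P where "P = (\<Prod>\<tau>\<in>\<Theta>. m \<tau>)"
  have "P > 0" unfolding P_def by (intro prod_pos) (metis m(2) gr0I not_less_zero)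
  have ex: "\<exists>f. (\<forall>x. f x \<in> {1..2 * P}) \<and>
    (\<forall>\<tau>\<in>\<Theta>. \<forall>S S'. finite S \<longrightarrow> finite S' \<longrightarrow> card (T \<tau> \<inter> S) \<le> 2 \<longrightarrow> card (T \<tau> \<inter> S') \<le> 2 \<longrightarrow>
      sum f S = sum f S' \<longrightarrow> card (T \<tau> \<inter> S) = card (T \<tau> \<inter> S'))" for T :: "'b \<Rightarrow> 'a set"
  proof -
    have "\<exists>y<P. \<forall>\<tau>\<in>\<Theta>. [y = (if x \<in> T \<tau> then 1 else 0)] (mod m \<tau>)" for x
    proof -
      have "\<forall>\<tau>\<in>\<Theta>. m \<tau> \<noteq> 0" using m(2) by (metis not_less_zero)
      then have "\<exists>!y. y < (\<Prod>\<tau>\<in>\<Theta>. m \<tau>) \<and> (\<forall>\<tau>\<in>\<Theta>. [y = (if x \<in> T \<tau> then 1 else 0)] (mod m \<tau>))"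
        using assms cop by (intro chinese_remainder_unique_nat) auto
      then show ?thesis unfolding P_def by (rule ex1_implies_ex)
    qed
    then obtain g where g: "\<And>x. g x < P" "\<And>x \<tau>. \<tau> \<in> \<Theta> \<Longrightarrow> [g x = (if x \<in> T \<tau> then 1 else 0)] (mod m \<tau>)"
      by metis
    \<comment> \<open>Adding \<open>P\<close> makes the labels positive and changes no residue,
      since every modulus divides \<open>P\<close>.\<close>
    define f where "f = (\<lambda>x. g x + P)"
    have sum: "[sum f S = card (T \<tau> \<inter> S)] (mod m \<tau>)" if \<tau>: "\<tau> \<in> \<Theta>" and S: "finite S" for \<tau> S
    proof -
      have "m \<tau> dvd P" unfolding P_def using assms \<tau> by (rule dvd_prodI)
      then have "[P = 0] (mod m \<tau>)" by (simp add: cong_0_iff)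
      then have "[f x = (if x \<in> T \<tau> then 1 else 0)] (mod m \<tau>)" for x
        using cong_add[OF g(2)[OF \<tau>, of x]] by (fastforce simp: f_def)
      then have "[sum f S = (\<Sum>x\<in>S. if x \<in> T \<tau> then 1 else 0)] (mod m \<tau>)" by (intro cong_sum)
      also have "(\<Sum>x\<in>S. if x \<in> T \<tau> then 1 else 0) = card (T \<tau> \<inter> S)"
        using S by (simp add: sum.If_cases Int_commute)
      finally show ?thesis .
    qed
    have "card (T \<tau> \<inter> S) = card (T \<tau> \<inter> S')"
      if "\<tau> \<in> \<Theta>" "finite S" "finite S'" "card (T \<tau> \<inter> S) \<le> 2" "card (T \<tau> \<inter> S') \<le> 2" "sum f S = sum f S'"
      for \<tau> S S'
    proof -
      have "[card (T \<tau> \<inter> S) = card (T \<tau> \<inter> S')] (mod m \<tau>)"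
        using sum[OF that(1,2)] sum[OF that(1,3)] that(6) by (metis cong_sym cong_trans)
      then show ?thesis
        using that(4,5) m(2)[of \<tau>] by (intro cong_less_modulus_unique_nat[of _ _ "m \<tau>"]) auto
    qed
    moreover have "f x \<in> {1..2 * P}" for x using g(1)[of x] by (auto simp: f_def)
    ultimately show ?thesis by blast
  qed
  show thesis by (rule that) (rule ex)
qed

text \<open>If A lies in some B, one point of A and one of B - A give counts 1 in A, 2 in B and 0 in
  all other members. If A meets some B without lying in it, a point of A inside B and one outside B
  both count for A, and no member contains both. If A meets no member, one point of A is
  enough.\<close>

lemma distinguishing_pair:
  assumes A: "A \<noteq> {}" and F: "\<And>B. B \<in> F \<Longrightarrow> B \<noteq> A"
    and disj: "\<And>B B'. B \<in> F \<Longrightarrow> B' \<in> F \<Longrightarrow> B \<noteq> B' \<Longrightarrow> B \<inter> B' = {}"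
  shows "\<exists>T \<subseteq> A \<union> \<Union>F. finite T \<and> card T \<le> 2 \<and> (\<forall>B\<in>F. card (T \<inter> A) \<noteq> card (T \<inter> B))"
proof -
  consider B where "B \<in> F" "A \<subseteq> B" | B where "B \<in> F" "A \<inter> B \<noteq> {}" "\<not> A \<subseteq> B"
    | "\<And>B. B \<in> F \<Longrightarrow> A \<inter> B = {}" by blast
  then show ?thesis
  proof cases
    case 1
    then obtain a b where ab: "a \<in> A" "b \<in> B" "b \<notin> A" using A F[OF 1(1)] by blast
    have "{a, b} \<inter> A = {a}" "{a, b} \<inter> B = {a, b}" using ab 1 by auto
    moreover have "{a, b} \<inter> B' = {}" if "B' \<in> F" "B' \<noteq> B" for B'
      using disj[OF that(1) 1(1) that(2)] ab 1(2) by blast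
    ultimately have "card ({a, b} \<inter> A) \<noteq> card ({a, b} \<inter> B')" if "B' \<in> F" for B'
      using that ab by (cases "B' = B") (auto simp: card_insert_if)
    then show ?thesis using ab 1 by (intro exI[of _ "{a, b}"]) (auto simp: card_insert_if)
  next
    case 2
    then obtain a b where ab: "a \<in> A" "a \<in> B" "b \<in> A" "b \<notin> B" by blast
    have "\<not> {a, b} \<subseteq> B'" if "B' \<in> F" for B'
      using disj[OF that 2(1)] ab by blast
    then have "card ({a, b} \<inter> B') < card {a, b}" if "B' \<in> F" for B'
      using that by (intro psubset_card_mono) auto
    moreover have "{a, b} \<inter> A = {a, b}" using ab by auto
    ultimately have "card ({a, b} \<inter> A) \<noteq> card ({a, b} \<inter> B')" if "B' \<in> F" for B'
      using that by (metis less_irrefl)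
    then show ?thesis using ab
      by (intro exI[of _ "{a, b}"]) (auto simp: card_insert_if)
  next
    case 3
    obtain a where a: "a \<in> A" using A by blast
    then have "{a} \<inter> A = {a}" "\<And>B. B \<in> F \<Longrightarrow> {a} \<inter> B = {}" using 3 by auto
    then show ?thesis using a by (intro exI[of _ "{a}"]) auto
  qed
qed

section \<open>Closed neighbourhoods restricted to one colour class\<close>

locale separated_colouring =
  fixes G :: "'a sgraph" and A :: "('a \<times> 'a) set" and col :: "'a \<Rightarrow> nat" and c :: nat
  assumes simple: "simple_graph G"
    and A: "A \<subseteq> adjacency G" "adjacency G \<subseteq> A \<union> A\<inverse>"
    and col: "\<And>v. v \<in> verts G \<Longrightarrow> col v \<le> c"
    and walks: "\<And>s t u v x. s \<le> 3 \<Longrightarrow> t \<le> 3 \<Longrightarrow> u \<in> verts G \<Longrightarrow> v \<in> verts G \<Longrightarrow>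
      (u, x) \<in> A ^^ s \<Longrightarrow> (v, x) \<in> A ^^ t \<Longrightarrow> col u = col v \<Longrightarrow> u = v"
begin

definition reach :: "nat \<Rightarrow> 'a \<Rightarrow> 'a \<Rightarrow> bool" where
  "reach n u x \<longleftrightarrow> (\<exists>s\<le>n. (u, x) \<in> A ^^ s)"

definition nbhd :: "nat \<Rightarrow> 'a \<Rightarrow> 'a set" where
  "nbhd k v = {x \<in> closed_nbhd G v. col x = k}"

text \<open>The radius 2 leads from a tail \<open>u\<close> through a head \<open>v\<close> to the
  out-neighbours of \<open>v\<close>. By \<open>walks\<close>, the cones of distinct vertices of one
  colour are disjoint, so points may be chosen in each cone independently.\<close>

definition cone :: "nat \<Rightarrow> 'a \<Rightarrow> 'a set" where
  "cone k u = {x. col x = k \<and> reach 2 u x}"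

lemma finite_verts: "finite (verts G)"
  using simple by (simp add: simple_graph_def)

lemma arc_verts: "(u, v) \<in> A \<Longrightarrow> u \<in> verts G \<and> v \<in> verts G"
  using A(1) adjacency_verts[OF simple] by blast

lemma reach_refl: "reach n u u"
  by (auto simp: reach_def intro: exI[of _ 0])

lemma reach_trans:
  assumes "reach n u x" "reach m x y"
  shows "reach (n + m) u y"
proof -
  obtain s t where "s \<le> n" "(u, x) \<in> A ^^ s" "t \<le> m" "(x, y) \<in> A ^^ t"
    using assms by (auto simp: reach_def)
  then have "s + t \<le> n + m" "(u, y) \<in> A ^^ (s + t)" using relpow_trans by simp_all
  then show ?thesis unfolding reach_def by blast
qed

lemma reach_arc: "(x, y) \<in> A \<Longrightarrow> reach (Suc n) x y"
  unfolding reach_def by (intro exI[of _ 1]) simp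

lemma reach_step: "reach n u x \<Longrightarrow> (x, y) \<in> A \<Longrightarrow> reach (Suc n) u y"
  using reach_trans[of n u x 1 y] reach_arc[of x y 0] by simp

lemma reach_unique:
  assumes "reach n u x" "reach m v x" "n \<le> 3" "m \<le> 3" "u \<in> verts G" "v \<in> verts G" "col u = col v"
  shows "u = v"
proof -
  obtain s t where "s \<le> n" "(u, x) \<in> A ^^ s" "t \<le> m" "(v, x) \<in> A ^^ t"
    using assms(1,2) by (auto simp: reach_def)
  then show ?thesis using walks[of s t u v x] assms(3-7) by simp
qed

lemma closed_nbhd_iff: "x \<in> closed_nbhd G v \<longleftrightarrow> x = v \<or> (x, v) \<in> A \<or> (v, x) \<in> A"
proof -
  have "(x, v) \<in> adjacency G \<longleftrightarrow> (x, v) \<in> A \<or> (v, x) \<in> A"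
    using A symD[OF sym_adjacency[of G]] by blast
  then show ?thesis by (auto simp: closed_nbhd_def adjacency_def)
qed

lemma nbhd_verts: "v \<in> verts G \<Longrightarrow> x \<in> nbhd k v \<Longrightarrow> x \<in> verts G"
  using arc_verts by (auto simp: nbhd_def closed_nbhd_iff)

lemma nbhd_cases:
  assumes "x \<in> nbhd k v"
  obtains "reach 1 x v" | "(v, x) \<in> A"
  using assms reach_refl[of 1] reach_arc[of x v 0] by (auto simp: nbhd_def closed_nbhd_iff)

text \<open>Suppose \<open>x\<close> is \<open>v\<close> or has an arc to \<open>v\<close>, and
  \<open>y\<close> is another member. If \<open>y\<close> is \<open>v\<close> or has an arc to
  \<open>v\<close>, walks from both meet in \<open>v\<close>; otherwise \<open>x\<close> walks to
  \<open>y\<close> through \<open>v\<close>. So a restricted neighbourhood is a single point or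
  consists of out-neighbours only.\<close>

lemma nbhd_singleton:
  assumes v: "v \<in> verts G" and x: "x \<in> nbhd k v" "reach 1 x v"
  shows "nbhd k v = {x}"
proof -
  have "y = x" if y: "y \<in> nbhd k v" for y
  proof -
    have xy: "x \<in> verts G" "y \<in> verts G" "col y = col x"
      using nbhd_verts[OF v] x y by (auto simp: nbhd_def)
    from y show ?thesis
    proof (cases rule: nbhd_cases)
      case 1
      then show ?thesis using reach_unique[of 1 y v 1 x] x xy by simp
    next
      case 2
      then have "reach 2 x y" using reach_step[OF x(2)] by (simp add: numeral_2_eq_2)
      then show ?thesis using reach_unique[OF reach_refl[of 0], of 2 x y] xy by simp
    qed
  qed
  then show ?thesis using x(1) by blast
qed

text \<open>Let \<open>x\<close> be a common member. Arcs from \<open>v\<close> and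
  \<open>v'\<close> to \<open>x\<close> meet, and an arc from one of them to \<open>x\<close>
  continues to the other if \<open>x\<close> points there or is it; both force v = v'. Otherwise
  \<open>x\<close> is \<open>v\<close> or points to it, likewise for \<open>v'\<close>, and both
  sets are {x}.\<close>

lemma nbhd_disjoint:
  assumes v: "v \<in> verts G" "v' \<in> verts G" "col v = col v'" and ne: "nbhd k v \<inter> nbhd k v' \<noteq> {}"
  shows "nbhd k v = nbhd k v'"
proof -
  obtain x where x: "x \<in> nbhd k v" "x \<in> nbhd k v'" using ne by blast
  have arc: "w = w'" if "w \<in> verts G" "w' \<in> verts G" "col w = col w'" "(w, x) \<in> A" "reach 1 x w'" for w w'
  proof -
    have "reach 2 w w'" using reach_trans[OF reach_arc[OF that(4), of 0] that(5)] by (simp add: numeral_2_eq_2)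
    then show ?thesis using reach_unique[of 2 w w' 0 w'] reach_refl[of 0 w'] that by simp
  qed
  from x(1) show ?thesis
  proof (cases rule: nbhd_cases)
    case 1
    from x(2) show ?thesis
    proof (cases rule: nbhd_cases)
      case 1
      then show ?thesis
        using nbhd_singleton[OF v(1) x(1) \<open>reach 1 x v\<close>] nbhd_singleton[OF v(2) x(2)] by simp
    next
      case 2
      then show ?thesis using arc[OF v(2,1) v(3)[symmetric] _ 1] by simp
    qed
  next
    case 2
    note vx = 2
    from x(2) show ?thesis
    proof (cases rule: nbhd_cases)
      case 1
      then show ?thesis using arc[OF v vx] by simp
    next
      case 2
      then have "v = v'"
        using reach_unique[of 1 v x 1 v'] reach_arc[OF vx, of 0] reach_arc[OF 2, of 0] v by simp
      then show ?thesis by simp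
    qed
  qed
qed

text \<open>One representative from each of the pairwise equal or disjoint sets. This settles edges
  for which exactly one of the two restricted neighbourhoods is empty.\<close>

lemma transversal:
  obtains T where "T \<subseteq> {x. col x = k}"
    "\<And>u. u \<in> verts G \<Longrightarrow> col u = i \<Longrightarrow> card (T \<inter> closed_nbhd G u) = (if nbhd k u = {} then 0 else 1)"
proof -
  define rep where "rep = (\<lambda>S::'a set. SOME x. x \<in> S)"
  have rep: "rep S \<in> S" if "S \<noteq> {}" for S using that by (auto simp: rep_def some_in_eq)
  define T where "T = {rep (nbhd k u) | u. u \<in> verts G \<and> col u = i \<and> nbhd k u \<noteq> {}}"
  have T: "T \<inter> closed_nbhd G u = (if nbhd k u = {} then {} else {rep (nbhd k u)})"
    if u: "u \<in> verts G" "col u = i" for u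
  proof -
    have only: "y \<in> nbhd k u \<and> y = rep (nbhd k u)" if y: "y \<in> T" "y \<in> closed_nbhd G u" for y
    proof -
      obtain u' where u': "y = rep (nbhd k u')" "u' \<in> verts G" "col u' = i" "nbhd k u' \<noteq> {}"
        using y(1) by (auto simp: T_def)
      then have yu': "y \<in> nbhd k u'" using rep by blast
      have "y \<in> nbhd k u" using yu' y(2) by (simp add: nbhd_def)
      moreover have "nbhd k u \<inter> nbhd k u' \<noteq> {}" using yu' calculation by blast
      then have "nbhd k u = nbhd k u'" using u u' by (intro nbhd_disjoint) auto
      ultimately show ?thesis using u'(1) by simp
    qed
    show ?thesis
    proof (cases "nbhd k u = {}")
      case True
      have "y \<notin> T \<inter> closed_nbhd G u" for y using only[of y] True by blast
      then have "T \<inter> closed_nbhd G u = {}" by blast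
      then show ?thesis using True by simp
    next
      case False
      have "rep (nbhd k u) \<in> T" using u False unfolding T_def by blast
      moreover have "rep (nbhd k u) \<in> closed_nbhd G u" using rep[OF False] by (simp add: nbhd_def)
      moreover have "T \<inter> closed_nbhd G u \<subseteq> {rep (nbhd k u)}" using only by blast
      ultimately have "T \<inter> closed_nbhd G u = {rep (nbhd k u)}" by blast
      then show ?thesis using False by simp
    qed
  qed
  have "T \<subseteq> {x. col x = k}"
  proof
    fix y assume "y \<in> T"
    then obtain u where "y = rep (nbhd k u)" "nbhd k u \<noteq> {}" by (auto simp: T_def)
    then have "y \<in> nbhd k u" using rep by simp
    then show "y \<in> {x. col x = k}" by (simp add: nbhd_def)
  qed
  moreover have "card (T \<inter> closed_nbhd G u) = (if nbhd k u = {} then 0 else 1)"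
    if "u \<in> verts G" "col u = i" for u using T[OF that] by simp
  ultimately show thesis using that by blast
qed

text \<open>A member \<open>x\<close> that is not an out-neighbour of \<open>u\<close> reaches
  \<open>v\<close> through \<open>u\<close>. Then every member of \<open>nbhd k v\<close> equals
  \<open>x\<close>, and both restricted neighbourhoods are {x}.\<close>

lemma nbhd_tail_subset_cone:
  assumes uv: "(u, v) \<in> A" and ne: "nbhd k v \<noteq> {}" "nbhd k u \<noteq> nbhd k v"
  shows "nbhd k u \<subseteq> cone k u"
proof
  fix x assume x: "x \<in> nbhd k u"
  have V: "u \<in> verts G" "v \<in> verts G" using arc_verts[OF uv] by auto
  from x show "x \<in> cone k u"
  proof (cases rule: nbhd_cases)
    case 2
    then show ?thesis using x reach_arc[OF 2, of 1] by (simp add: cone_def nbhd_def numeral_2_eq_2)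
  next
    case 1
    have "reach 2 x v" using reach_step[OF 1 uv] by (simp add: numeral_2_eq_2)
    have "y = x" if y: "y \<in> nbhd k v" for y
    proof -
      have xy: "x \<in> verts G" "y \<in> verts G" "col y = col x"
        using nbhd_verts V x y by (auto simp: nbhd_def)
      from y show ?thesis
      proof (cases rule: nbhd_cases)
        case 1
        then show ?thesis using reach_unique[of 1 y v 2 x] \<open>reach 2 x v\<close> xy by simp
      next
        case 2
        \<comment> \<open>The walk x, u, v, y uses the full length three.\<close>
        then have "reach 3 x y" using reach_step[OF \<open>reach 2 x v\<close>] by (simp add: numeral_3_eq_3 numeral_2_eq_2)
        then show ?thesis using reach_unique[OF reach_refl[of 0], of 3 x y] xy by simp
      qed
    qed
    then have "nbhd k v = {x}" using ne(1) by blast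
    then show ?thesis using nbhd_singleton[OF V(1) x 1] ne(2) by simp
  qed
qed

text \<open>Out-neighbours of \<open>v\<close> lie in the cone of \<open>u\<close>. Otherwise the
  set is a single \<open>x\<close> that is \<open>v\<close> or points to it. A cone around
  \<open>u'\<close> that contains \<open>x\<close> gives a walk of length at most 3 from
  \<open>u'\<close> to \<open>v\<close>, which meets the arc from \<open>u\<close>; so u' =
  u.\<close>

lemma nbhd_head_cone:
  assumes uv: "(u, v) \<in> A"
  shows "nbhd k v \<subseteq> cone k u \<or> (\<forall>u'\<in>verts G. col u' = col u \<longrightarrow> nbhd k v \<inter> cone k u' = {})"
proof -
  have V: "u \<in> verts G" "v \<in> verts G" using arc_verts[OF uv] by auto
  show ?thesis
  proof (cases "\<exists>x\<in>nbhd k v. reach 1 x v")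
    case False
    have "x \<in> cone k u" if "x \<in> nbhd k v" for x
    proof -
      have "(v, x) \<in> A" using that False nbhd_cases by blast
      then have "reach 2 u x" using reach_step[OF reach_arc[OF uv, of 0]] by (simp add: numeral_2_eq_2)
      then show ?thesis using that by (simp add: cone_def nbhd_def)
    qed
    then show ?thesis by blast
  next
    case True
    then obtain x where x: "x \<in> nbhd k v" "reach 1 x v" by blast
    have one: "nbhd k v = {x}" using nbhd_singleton[OF V(2) x] .
    have "u' = u" if "u' \<in> verts G" "col u' = col u" "x \<in> cone k u'" for u'
    proof -
      have "reach 3 u' v"
        using reach_trans[of 2 u' x 1 v] x(2) that(3) by (simp add: cone_def)
      then show ?thesis
        using reach_unique[of 3 u' v 1 u] reach_arc[OF uv, of 0] V that by simp
    qed
    then show ?thesis using one by (cases "x \<in> cone k u") auto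
  qed
qed

text \<open>This settles edges with both restricted neighbourhoods nonempty. In the cone of each
  tail \<open>u\<close>, \<open>distinguishing_pair\<close> separates \<open>nbhd k u\<close> from
  the traces of all possible heads at once, since these traces are equal or disjoint. One choice
  thus serves all arcs that leave \<open>u\<close>.\<close>

lemma cone_distinguisher:
  obtains T where "T \<subseteq> {x. col x = k}"
    "\<And>u v. (u, v) \<in> A \<Longrightarrow> col u = i \<Longrightarrow> col v = j \<Longrightarrow> nbhd k u \<noteq> {} \<Longrightarrow> nbhd k v \<noteq> {} \<Longrightarrow>
      nbhd k u \<noteq> nbhd k v \<Longrightarrow> card (T \<inter> closed_nbhd G u) \<noteq> card (T \<inter> closed_nbhd G v) \<and>
      card (T \<inter> closed_nbhd G u) \<le> 2 \<and> card (T \<inter> closed_nbhd G v) \<le> 2"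
proof -
  \<comment> \<open>Traces on the cone are used because only the points of \<open>T\<close> in this
    cone are controlled by the choice at \<open>u\<close>.\<close>
  define F where "F = (\<lambda>u. {nbhd k v \<inter> cone k u | v. v \<in> verts G \<and> col v = j} - {nbhd k u})"
  define good where "good = (\<lambda>u T. T \<subseteq> cone k u \<and> finite T \<and> card T \<le> 2 \<and>
      (nbhd k u \<noteq> {} \<and> nbhd k u \<subseteq> cone k u \<longrightarrow> (\<forall>B\<in>F u. card (T \<inter> nbhd k u) \<noteq> card (T \<inter> B))))"
  have "\<exists>T. good u T" for u
  proof (cases "nbhd k u \<noteq> {} \<and> nbhd k u \<subseteq> cone k u")
    case True
    have "\<exists>T \<subseteq> nbhd k u \<union> \<Union>(F u). finite T \<and> card T \<le> 2 \<and> (\<forall>B\<in>F u. card (T \<inter> nbhd k u) \<noteq> card (T \<inter> B))"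
    proof (rule distinguishing_pair)
      show "B \<inter> B' = {}" if "B \<in> F u" "B' \<in> F u" "B \<noteq> B'" for B B'
      proof -
        obtain v v' where v: "B = nbhd k v \<inter> cone k u" "v \<in> verts G" "col v = j"
          "B' = nbhd k v' \<inter> cone k u" "v' \<in> verts G" "col v' = j" using \<open>B \<in> F u\<close> \<open>B' \<in> F u\<close> by (auto simp: F_def)
        then have "nbhd k v \<inter> nbhd k v' = {}" using nbhd_disjoint[of v v' k] \<open>B \<noteq> B'\<close> by auto
        then show ?thesis using v by blast
      qed
    qed (use True in \<open>auto simp: F_def\<close>)
    moreover have "nbhd k u \<union> \<Union>(F u) \<subseteq> cone k u" using True by (auto simp: F_def)
    ultimately show ?thesis unfolding good_def by (meson order_trans)
  next
    case False
    then show ?thesis unfolding good_def by (intro exI[of _ "{}"]) auto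
  qed
  then obtain P where "\<And>u. good u (P u)" by metis
  then have P: "\<And>u. P u \<subseteq> cone k u" "\<And>u. finite (P u)" "\<And>u. card (P u) \<le> 2"
      "\<And>u B. nbhd k u \<noteq> {} \<Longrightarrow> nbhd k u \<subseteq> cone k u \<Longrightarrow> B \<in> F u \<Longrightarrow> card (P u \<inter> nbhd k u) \<noteq> card (P u \<inter> B)"
    unfolding good_def by simp_all
  define T where "T = (\<Union>u\<in>{u \<in> verts G. col u = i}. P u)"
  have Tcol: "T \<subseteq> {x. col x = k}" using P(1) by (auto simp: T_def cone_def)
  have TN: "T \<inter> closed_nbhd G w = T \<inter> nbhd k w" for w
    using Tcol by (auto simp: nbhd_def)
  \<comment> \<open>Disjointness of cones: the choices made for other tails of colour
    \<open>i\<close> do not disturb this one.\<close>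
  have TP: "T \<inter> cone k u = P u" if u: "u \<in> verts G" "col u = i" for u
  proof -
    have "u' = u" if "u' \<in> verts G" "col u' = i" "x \<in> P u'" "x \<in> cone k u" for u' x
      using reach_unique[of 2 u' x 2 u] P(1)[of u'] that u by (auto simp: cone_def)
    then show ?thesis using P(1)[of u] u by (auto simp: T_def)
  qed
  have "card (T \<inter> closed_nbhd G u) \<noteq> card (T \<inter> closed_nbhd G v) \<and>
      card (T \<inter> closed_nbhd G u) \<le> 2 \<and> card (T \<inter> closed_nbhd G v) \<le> 2"
    if uv: "(u, v) \<in> A" "col u = i" "col v = j" and ne: "nbhd k u \<noteq> {}" "nbhd k v \<noteq> {}" "nbhd k u \<noteq> nbhd k v" for u v
  proof -
    have V: "u \<in> verts G" "v \<in> verts G" using arc_verts[OF uv(1)] by auto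
    have cu: "nbhd k u \<subseteq> cone k u" using nbhd_tail_subset_cone[OF uv(1) ne(2,3)] .
    have Tu: "T \<inter> nbhd k u = P u \<inter> nbhd k u" using TP[OF V(1) uv(2)] cu by blast
    have head: "nbhd k v \<subseteq> cone k u \<or> T \<inter> nbhd k v = {} \<and> nbhd k v \<inter> cone k u = {}"
      using nbhd_head_cone[OF uv(1), of k]
    proof (elim disjE)
      assume apart: "\<forall>u'\<in>verts G. col u' = col u \<longrightarrow> nbhd k v \<inter> cone k u' = {}"
      have "x \<notin> nbhd k v" if "x \<in> T" for x
      proof -
        obtain u' where "u' \<in> verts G" "col u' = i" "x \<in> cone k u'"
          using \<open>x \<in> T\<close> P(1) by (auto simp: T_def)
        then show ?thesis using apart uv(2) by auto
      qed
      then have "T \<inter> nbhd k v = {}" by blast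
      moreover have "nbhd k v \<inter> cone k u = {}" using apart V(1) by simp
      ultimately show ?thesis by simp
    qed simp
    then have Tv: "T \<inter> nbhd k v = P u \<inter> (nbhd k v \<inter> cone k u)"
      using TP[OF V(1) uv(2)] by blast
    \<comment> \<open>If the head set lies in the cone, its trace is the whole set, which differs
      from \<open>nbhd k u\<close>; if it misses the cone, the trace is empty while
      \<open>nbhd k u\<close> is not.\<close>
    have "nbhd k v \<inter> cone k u \<noteq> nbhd k u" using head ne by (metis Int_absorb2)
    then have "nbhd k v \<inter> cone k u \<in> F u" using V uv by (auto simp: F_def)
    then have "card (P u \<inter> nbhd k u) \<noteq> card (P u \<inter> (nbhd k v \<inter> cone k u))" using P(4)[OF ne(1) cu] by blast
    moreover have "card (P u \<inter> X) \<le> 2" for X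
      using card_mono[OF P(2)[of u], of "P u \<inter> X"] P(3)[of u] by simp
    ultimately show ?thesis unfolding TN Tu Tv by blast
  qed
  then show thesis using that Tcol by blast
qed

lemma distinguishing_sets:
  obtains T :: "nat \<times> nat \<times> nat \<Rightarrow> 'a set" where
    "\<And>u v. {u, v} \<in> edges G \<Longrightarrow> closed_nbhd G u \<noteq> closed_nbhd G v \<Longrightarrow>
      \<exists>\<tau>\<in>{..c} \<times> {..Suc c} \<times> {..c}. card (T \<tau> \<inter> closed_nbhd G u) \<noteq> card (T \<tau> \<inter> closed_nbhd G v) \<and>
        card (T \<tau> \<inter> closed_nbhd G u) \<le> 2 \<and> card (T \<tau> \<inter> closed_nbhd G v) \<le> 2"
proof -
  let ?N = "closed_nbhd G"
  define hits where "hits = (\<lambda>i k T. T \<subseteq> {x. col x = k} \<and>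
      (\<forall>u. u \<in> verts G \<longrightarrow> col u = i \<longrightarrow> card (T \<inter> ?N u) = (if nbhd k u = {} then 0 else 1)))"
  have "\<exists>T. hits i k T" for i k
    unfolding hits_def by (rule transversal[of k i]) blast
  then obtain R where "\<And>i k. hits i k (R i k)" by metis
  then have R: "\<And>i k. R i k \<subseteq> {x. col x = k}" "\<And>i k u. u \<in> verts G \<Longrightarrow> col u = i \<Longrightarrow>
      card (R i k \<inter> ?N u) = (if nbhd k u = {} then 0 else 1)"
    unfolding hits_def by simp_all
  define good where "good = (\<lambda>i j k T. \<forall>u v. (u, v) \<in> A \<longrightarrow> col u = i \<longrightarrow> col v = j \<longrightarrow> nbhd k u \<noteq> {} \<longrightarrow> nbhd k v \<noteq> {} \<longrightarrow>
      nbhd k u \<noteq> nbhd k v \<longrightarrow> card (T \<inter> ?N u) \<noteq> card (T \<inter> ?N v) \<and>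
      card (T \<inter> ?N u) \<le> 2 \<and> card (T \<inter> ?N v) \<le> 2)"
  have "\<exists>T. good i j k T" for i j k
    unfolding good_def by (rule cone_distinguisher[of k i j]) blast
  then obtain Q where "\<And>i j k. good i j k (Q i j k)" by metis
  then have Q: "\<And>i j k u v. (u, v) \<in> A \<Longrightarrow> col u = i \<Longrightarrow> col v = j \<Longrightarrow> nbhd k u \<noteq> {} \<Longrightarrow>
      nbhd k v \<noteq> {} \<Longrightarrow> nbhd k u \<noteq> nbhd k v \<Longrightarrow> card (Q i j k \<inter> ?N u) \<noteq> card (Q i j k \<inter> ?N v) \<and>
      card (Q i j k \<inter> ?N u) \<le> 2 \<and> card (Q i j k \<inter> ?N v) \<le> 2"
    unfolding good_def by blast
  \<comment> \<open>\<open>Suc c\<close> exceeds all colours; as second entry of an index it marks a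
    transversal instead of a colour of the head.\<close>
  define T where "T = (\<lambda>(i, j, k). if j \<le> c then Q i j k else R i k)"
  define sep where "sep = (\<lambda>u v \<tau>. card (T \<tau> \<inter> ?N u) \<noteq> card (T \<tau> \<inter> ?N v) \<and>
      card (T \<tau> \<inter> ?N u) \<le> 2 \<and> card (T \<tau> \<inter> ?N v) \<le> 2)"
  have arc: "\<exists>\<tau>\<in>{..c} \<times> {..Suc c} \<times> {..c}. sep u v \<tau>" if uv: "(u, v) \<in> A" "?N u \<noteq> ?N v" for u v
  proof -
    have V: "u \<in> verts G" "v \<in> verts G" using arc_verts[OF uv(1)] by auto
    obtain x where x: "x \<in> ?N u \<longleftrightarrow> x \<notin> ?N v" using uv(2) by blast
    let ?k = "col x"
    have "x \<in> verts G" using x V arc_verts by (auto simp: closed_nbhd_iff)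
    then have k: "?k \<le> c" using col by blast
    have ne: "nbhd ?k u \<noteq> nbhd ?k v" using x by (auto simp: nbhd_def)
    have cuv: "col u \<le> c" "col v \<le> c" using col V by auto
    consider "nbhd ?k u \<noteq> {}" "nbhd ?k v \<noteq> {}" | "nbhd ?k u = {}" "nbhd ?k v \<noteq> {}"
      | "nbhd ?k u \<noteq> {}" "nbhd ?k v = {}" using ne by blast
    then show ?thesis
    proof cases
      case 1
      then have "sep u v (col u, col v, ?k)"
        using Q[OF uv(1) refl refl _ _ ne] cuv by (simp add: sep_def T_def)
      then show ?thesis using cuv k by (intro bexI[of _ "(col u, col v, ?k)"]) auto
    next
      case 2
      have "R (col v) ?k \<inter> ?N u = {}" using R(1)[of "col v" ?k] 2(1) by (auto simp: nbhd_def)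
      then have "sep u v (col v, Suc c, ?k)"
        using R(2)[OF V(2) refl, of ?k] 2 by (simp add: sep_def T_def)
      then show ?thesis using cuv k by (intro bexI[of _ "(col v, Suc c, ?k)"]) auto
    next
      case 3
      have "R (col u) ?k \<inter> ?N v = {}" using R(1)[of "col u" ?k] 3(2) by (auto simp: nbhd_def)
      then have "sep u v (col u, Suc c, ?k)"
        using R(2)[OF V(1) refl, of ?k] 3 by (simp add: sep_def T_def)
      then show ?thesis using cuv k by (intro bexI[of _ "(col u, Suc c, ?k)"]) auto
    qed
  qed
  have "\<exists>\<tau>\<in>{..c} \<times> {..Suc c} \<times> {..c}. sep u v \<tau>" if uv: "{u, v} \<in> edges G" "?N u \<noteq> ?N v" for u v
  proof -
    have "(u, v) \<in> A \<or> (v, u) \<in> A" using uv(1) A(2) by (auto simp: adjacency_def)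
    moreover have "sep u v \<tau>" if "sep v u \<tau>" for \<tau> using that by (auto simp: sep_def)
    ultimately show ?thesis using arc uv(2) by metis
  qed
  then show thesis using that[of T] by (simp add: sep_def)
qed

end

text \<open>The index set of triples, and with it \<open>l\<close>, depends on the number of colours
  alone; only the sets \<open>T\<close> and the labels vary with the graph.\<close>

lemma bounded_expansion_bounded_dis:
  assumes "bounded_expansion (C :: 'a sgraph set)"
  shows "\<exists>c. \<forall>G\<in>C. dis G \<le> c"
proof -
  have sp: "sparse_minors C" using assms by (rule bounded_expansion_sparse_minors)
  obtain c where c: "\<forall>G\<in>C. \<exists>A f. A \<subseteq> adjacency G \<and> adjacency G \<subseteq> A \<union> A\<inverse> \<and>
      (\<forall>v\<in>verts G. f v \<le> (c::nat)) \<and>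
      (\<forall>s\<le>3. \<forall>t\<le>3. \<forall>u\<in>verts G. \<forall>v\<in>verts G. \<forall>x. (u, x) \<in> A ^^ s \<longrightarrow> (v, x) \<in> A ^^ t \<longrightarrow> f u = f v \<longrightarrow> u = v)"
    using separating_colouring[OF sp] by (elim exE)
  let ?\<Theta> = "{..c} \<times> {..Suc c} \<times> {..c}"
  have fin: "finite ?\<Theta>" by simp
  obtain l :: nat where l: "\<And>T :: nat \<times> nat \<times> nat \<Rightarrow> 'a set. \<exists>f. (\<forall>x. f x \<in> {1..l}) \<and>
    (\<forall>\<tau>\<in>?\<Theta>. \<forall>S S'. finite S \<longrightarrow> finite S' \<longrightarrow> card (T \<tau> \<inter> S) \<le> 2 \<longrightarrow> card (T \<tau> \<inter> S') \<le> 2 \<longrightarrow>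
      sum f S = sum f S' \<longrightarrow> card (T \<tau> \<inter> S) = card (T \<tau> \<inter> S'))"
    by (rule residue_labels[OF fin]) (rule that; assumption)
  have "dis G \<le> l" if G: "G \<in> C" for G
  proof -
    have simple: "simple_graph G" using sp G by (simp add: sparse_minors_def)
    obtain A col where Ac: "A \<subseteq> adjacency G \<and> adjacency G \<subseteq> A \<union> A\<inverse> \<and> (\<forall>v\<in>verts G. col v \<le> c) \<and>
      (\<forall>s\<le>3. \<forall>t\<le>3. \<forall>u\<in>verts G. \<forall>v\<in>verts G. \<forall>x. (u, x) \<in> A ^^ s \<longrightarrow> (v, x) \<in> A ^^ t \<longrightarrow> col u = col v \<longrightarrow> u = v)"
      using bspec[OF c G] by (elim exE)
    interpret separated_colouring G A col c
    proof
      fix s t u v x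
      assume "s \<le> 3" "t \<le> 3" "u \<in> verts G" "v \<in> verts G" "(u, x) \<in> A ^^ s" "(v, x) \<in> A ^^ t" "col u = col v"
      then show "u = v" by (rule Ac[THEN conjunct2, THEN conjunct2, THEN conjunct2, rule_format])
    qed (use simple Ac[THEN conjunct1] Ac[THEN conjunct2, THEN conjunct1]
        Ac[THEN conjunct2, THEN conjunct2, THEN conjunct1] in simp_all)
    obtain T where T: "\<And>u v. {u, v} \<in> edges G \<Longrightarrow> closed_nbhd G u \<noteq> closed_nbhd G v \<Longrightarrow>
      \<exists>\<tau>\<in>?\<Theta>. card (T \<tau> \<inter> closed_nbhd G u) \<noteq> card (T \<tau> \<inter> closed_nbhd G v) \<and>
        card (T \<tau> \<inter> closed_nbhd G u) \<le> 2 \<and> card (T \<tau> \<inter> closed_nbhd G v) \<le> 2"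
      by (rule distinguishing_sets) (rule that; assumption)
    obtain f where f: "(\<forall>x. f x \<in> {1..l}) \<and>
      (\<forall>\<tau>\<in>?\<Theta>. \<forall>S S'. finite S \<longrightarrow> finite S' \<longrightarrow> card (T \<tau> \<inter> S) \<le> 2 \<longrightarrow> card (T \<tau> \<inter> S') \<le> 2 \<longrightarrow>
      sum f S = sum f S' \<longrightarrow> card (T \<tau> \<inter> S) = card (T \<tau> \<inter> S'))"
      using l[of T] by (elim exE)
    have fin: "finite (closed_nbhd G v)" for v
      by (rule finite_subset[of _ "insert v (verts G)"])
        (use arc_verts finite_verts in \<open>auto simp: closed_nbhd_iff\<close>)
    have "distinguishing G f"
      unfolding distinguishing_def
    proof (intro allI impI notI)
      fix u v
      assume uv: "{u, v} \<in> edges G \<and> closed_nbhd G u \<noteq> closed_nbhd G v"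
        and eq: "sum f (closed_nbhd G u) = sum f (closed_nbhd G v)"
      obtain \<tau> where "\<tau> \<in> ?\<Theta>" "card (T \<tau> \<inter> closed_nbhd G u) \<noteq> card (T \<tau> \<inter> closed_nbhd G v)"
        "card (T \<tau> \<inter> closed_nbhd G u) \<le> 2" "card (T \<tau> \<inter> closed_nbhd G v) \<le> 2"
        using T uv by blast
      then show False using f[THEN conjunct2, rule_format, OF _ fin fin _ _ eq] by blast
    qed
    moreover have "l \<ge> 1" using f by (meson atLeastAtMost_iff order_trans)
    ultimately show ?thesis unfolding dis_def using f by (intro Least_le conjI exI[of _ f]) simp_all
  qed
  then show ?thesis by blast
qed

subsection \<open>Theta curves\<close>

lemma connected_subset_inside:
  assumes "connected S" "z \<in> S" "z \<in> inside C" "S \<inter> C = {}"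
  shows "S \<subseteq> inside C"
  using assms
  by (meson connected_component_def disjoint_eq_subset_Compl inside_same_component subsetI)

lemma connected_subset_outside:
  assumes "connected S" "z \<in> S" "z \<in> outside C" "S \<inter> C = {}"
  shows "S \<subseteq> outside C"
  using assms
  by (meson connected_component_def disjoint_eq_subset_Compl outside_same_component subsetI)

text \<open>The component of \<open>z\<close> off \<open>C\<close> misses \<open>D\<close>. Unlike
  inside and outside, this notion treats the three arcs of a theta curve alike and can be pulled
  back along an inversion.\<close>

definition shields :: "complex \<Rightarrow> complex set \<Rightarrow> complex set \<Rightarrow> bool" where
  "shields z C D \<longleftrightarrow> (\<forall>S. connected S \<and> z \<in> S \<and> S \<inter> C = {} \<longrightarrow> S \<inter> D = {})"

lemma simple_closed_curve_of_arcs: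
  fixes c1 c2 :: "real \<Rightarrow> complex"
  assumes "arc c1" "pathstart c1 = a" "pathfinish c1 = b"
    and "arc c2" "pathstart c2 = a" "pathfinish c2 = b"
    and "path_image c1 \<inter> path_image c2 = {a,b}"
  obtains c where "simple_path c" "pathfinish c = pathstart c"
    "path_image c = path_image c1 \<union> path_image c2"
proof
  show "simple_path (c1 +++ reversepath c2)"
    using assms by (simp add: simple_path_join_loop_eq arc_reversepath)
  show "pathfinish (c1 +++ reversepath c2) = pathstart (c1 +++ reversepath c2)"
    using assms by simp
  show "path_image (c1 +++ reversepath c2) = path_image c1 \<union> path_image c2"
    using assms by (simp add: path_image_join)
qed

text \<open>The third arc splits the interior of the closed curve into two regions. From outside the
  curve the third arc is unreachable; from either region, the boundary arc of the other region
  is.\<close>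

lemma theta_shields_inside:
  fixes c1 c2 c3 :: "real \<Rightarrow> complex"
  assumes c1: "arc c1" "pathstart c1 = a" "pathfinish c1 = b"
    and c2: "arc c2" "pathstart c2 = a" "pathfinish c2 = b"
    and c3: "arc c3" "pathstart c3 = a" "pathfinish c3 = b"
    and c12: "path_image c1 \<inter> path_image c2 = {a,b}"
    and c13: "path_image c1 \<inter> path_image c3 = {a,b}"
    and c23: "path_image c2 \<inter> path_image c3 = {a,b}"
    and meets: "path_image c3 \<inter> inside (path_image c1 \<union> path_image c2) \<noteq> {}"
    and z: "z \<notin> path_image c1 \<union> path_image c2 \<union> path_image c3"
  shows "shields z (path_image c1 \<union> path_image c2) (path_image c3) \<or>
         shields z (path_image c1 \<union> path_image c3) (path_image c2) \<or>
         shields z (path_image c2 \<union> path_image c3) (path_image c1)"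
proof -
  let ?C = "path_image c1 \<union> path_image c2"
  have ab: "a \<noteq> b" using c1 arc_distinct_ends by blast
  obtain split: "inside (path_image c1 \<union> path_image c3) \<union> inside (path_image c2 \<union> path_image c3) \<union>
           (path_image c3 - {a,b}) = inside ?C"
    using split_inside_simple_closed_curve[OF arc_imp_simple_path[OF c1(1)] c1(2,3)
        arc_imp_simple_path[OF c2(1)] c2(2,3) arc_imp_simple_path[OF c3(1)] c3(2,3)
        ab c12 c13 c23 meets] by blast
  consider "z \<notin> inside ?C" | "z \<in> inside (path_image c1 \<union> path_image c3)"
    | "z \<in> inside (path_image c2 \<union> path_image c3)"
    using split z by blast
  then show ?thesis
  proof cases
    case 1
    then have zo: "z \<in> outside ?C" using z inside_Un_outside[of ?C] by blast
    have "shields z ?C (path_image c3)"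
      unfolding shields_def
    proof (intro allI impI)
      fix S assume S: "connected S \<and> z \<in> S \<and> S \<inter> ?C = {}"
      then have "S \<subseteq> outside ?C" using connected_subset_outside zo by blast
      then have "S \<inter> inside ?C = {}" using inside_Int_outside[of ?C] by blast
      then show "S \<inter> path_image c3 = {}" using split S c12 by blast
    qed
    then show ?thesis by blast
  next
    case 2
    have "shields z (path_image c1 \<union> path_image c3) (path_image c2)"
      unfolding shields_def
    proof (intro allI impI)
      fix S assume S: "connected S \<and> z \<in> S \<and> S \<inter> (path_image c1 \<union> path_image c3) = {}"
      then have "S \<subseteq> inside (path_image c1 \<union> path_image c3)"
        using connected_subset_inside 2 by blast
      then have "S \<subseteq> inside ?C" using split by blast
      then show "S \<inter> path_image c2 = {}" using inside_no_overlap[of ?C] by blast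
    qed
    then show ?thesis by blast
  next
    case 3
    have "shields z (path_image c2 \<union> path_image c3) (path_image c1)"
      unfolding shields_def
    proof (intro allI impI)
      fix S assume S: "connected S \<and> z \<in> S \<and> S \<inter> (path_image c2 \<union> path_image c3) = {}"
      then have "S \<subseteq> inside (path_image c2 \<union> path_image c3)"
        using connected_subset_inside 3 by blast
      then have "S \<subseteq> inside ?C" using split by blast
      then show "S \<inter> path_image c1 = {}" using inside_no_overlap[of ?C] by blast
    qed
    then show ?thesis by blast
  qed
qed

text \<open>Otherwise the image of the exterior lies outside the image curve. The image of the
  punctured interior is connected and unbounded, so it also misses the bounded inside. Nothing but
  the value at \<open>w\<close> is left to fill a nonempty open set.\<close>

lemma inversion_swaps_sides:
  fixes c :: "real \<Rightarrow> complex" and w :: complex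
  defines "\<phi> \<equiv> \<lambda>z. inverse (z - w)"
  assumes c: "simple_path c" "pathfinish c = pathstart c"
    and w: "w \<in> inside (path_image c)" and p: "p \<in> outside (path_image c)"
  shows "\<phi> p \<in> inside (\<phi> ` path_image c)"
proof (rule ccontr)
  let ?C = "path_image c"
  assume np: "\<phi> p \<notin> inside (\<phi> ` ?C)"
  have J: "open (inside ?C)" "connected (inside ?C)" "connected (outside ?C)"
    using Jordan_inside_outside[OF c] by auto
  have wC: "w \<notin> ?C" "w \<notin> outside ?C"
    using w inside_no_overlap[of ?C] inside_Int_outside[of ?C] by blast+
  have inj: "\<phi> x = \<phi> y \<longleftrightarrow> x = y" for x y
    by (simp add: \<phi>_def)
  then have "inj \<phi>" by (simp add: inj_def)
  note mem = inj_image_mem_iff[OF this]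
  have disj: "\<phi> ` X \<inter> \<phi> ` Y = {}" if "X \<inter> Y = {}" for X Y
    using that image_Int[OF \<open>inj \<phi>\<close>, of X Y] by simp
  have cont: "continuous_on S \<phi>" if "w \<notin> S" for S
    unfolding \<phi>_def using that by (intro continuous_intros) auto
  have pC: "p \<notin> ?C" using p outside_no_overlap[of ?C] by blast
  have "simple_path (\<phi> \<circ> c)"
    using c(1) path_continuous_image[OF _ cont[OF wC(1)]] unfolding simple_path_def loop_free_def
    by (simp add: inj)
  moreover have "pathfinish (\<phi> \<circ> c) = pathstart (\<phi> \<circ> c)"
    using c(2) by (simp add: pathfinish_compose pathstart_compose)
  ultimately have J': "inside (\<phi> ` ?C) \<noteq> {}" "open (inside (\<phi> ` ?C))" "bounded (inside (\<phi> ` ?C))"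
    using Jordan_inside_outside[of "\<phi> \<circ> c"] by (auto simp: path_image_compose)
  have "\<phi> p \<notin> \<phi> ` ?C" using pC mem by blast
  then have po: "\<phi> p \<in> outside (\<phi> ` ?C)"
    using np inside_Un_outside[of "\<phi> ` ?C"] by blast
  have out: "\<phi> ` outside ?C \<subseteq> outside (\<phi> ` ?C)"
  proof (rule connected_subset_outside[OF _ _ po])
    show "connected (\<phi> ` outside ?C)"
      using J(3) cont[OF wC(2)] by (rule connected_continuous_image[rotated])
    show "\<phi> ` outside ?C \<inter> \<phi> ` ?C = {}" using outside_no_overlap[of ?C] by (intro disj) blast
  qed (use p in blast)
  have ub: "\<not> bounded (\<phi> ` (inside ?C - {w}))"
  proof
    assume "bounded (\<phi> ` (inside ?C - {w}))"
    then obtain B where B: "B > 0" "\<And>x. x \<in> inside ?C - {w} \<Longrightarrow> norm (\<phi> x) \<le> B"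
      unfolding bounded_pos by blast
    obtain e where e: "e > 0" "ball w e \<subseteq> inside ?C"
      using J(1) w open_contains_ball by blast
    define d where "d = min (e/2) (inverse (B + 1))"
    have d: "d > 0" "d < e" "d \<le> inverse (B+1)" using e(1) B(1) by (auto simp: d_def min_def)
    have "w + of_real d \<in> inside ?C - {w}" using d e(2) by (auto simp: dist_norm subset_iff)
    then have "norm (\<phi> (w + of_real d)) \<le> B" using B(2) by blast
    then have "inverse d \<le> B" using d(1) by (simp add: \<phi>_def norm_inverse)
    moreover have "B + 1 \<le> inverse d"
      using d(1,3) B(1) by (metis add_pos_pos inverse_inverse_eq le_imp_inverse_le zero_less_one)
    ultimately show False by simp
  qed
  have inn: "\<phi> ` (inside ?C - {w}) \<inter> inside (\<phi> ` ?C) = {}"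
  proof (rule ccontr)
    assume "\<not> ?thesis"
    then obtain x where x: "x \<in> inside ?C - {w}" "\<phi> x \<in> inside (\<phi> ` ?C)" by blast
    have "\<phi> ` (inside ?C - {w}) \<subseteq> inside (\<phi> ` ?C)"
    proof (rule connected_subset_inside[OF _ _ x(2)])
      have "connected (inside ?C - {w})"
        using J by (intro connected_open_delete) auto
      then show "connected (\<phi> ` (inside ?C - {w}))"
        using cont by (intro connected_continuous_image) auto
      show "\<phi> ` (inside ?C - {w}) \<inter> \<phi> ` ?C = {}" using inside_no_overlap[of ?C] by (intro disj) blast
    qed (use x in blast)
    then show False using ub J'(3) bounded_subset by blast
  qed
  \<comment> \<open>Since \<open>inverse 0 = 0\<close>, the total function \<open>\<phi>\<close>
    sends \<open>w\<close> to 0 and is injective on the whole plane; 0 is the one value not taken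
    off \<open>w\<close>.\<close>
  have "inside (\<phi> ` ?C) \<subseteq> {0}"
  proof
    fix y assume y: "y \<in> inside (\<phi> ` ?C)"
    show "y \<in> {0}"
    proof (rule ccontr)
      assume "y \<notin> {0}"
      then have x: "\<phi> (w + inverse y) = y" "w + inverse y \<noteq> w" by (auto simp: \<phi>_def)
      have "w + inverse y \<notin> ?C" using x(1) y inside_no_overlap[of "\<phi> ` ?C"] by (metis IntI empty_iff imageI)
      then have "w + inverse y \<in> inside ?C - {w} \<or> w + inverse y \<in> outside ?C"
        using x(2) inside_Un_outside[of ?C] by blast
      then show False
        using inn out x(1) y inside_Int_outside[of "\<phi> ` ?C"] by (metis IntI empty_iff imageI subsetD)
    qed
  qed
  then have "finite (inside (\<phi> ` ?C))" using finite_subset by blast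
  then show False using J' finite_imp_not_open by blast
qed

text \<open>If the third arc stays out of the interior of the other two, inverting about a point
  \<open>w\<close> of that interior brings it inside. Choosing \<open>w\<close> different from
  \<open>z\<close> keeps \<open>z\<close> available.\<close>

lemma theta_shields:
  fixes c1 c2 c3 :: "real \<Rightarrow> complex"
  assumes c1: "arc c1" "pathstart c1 = a" "pathfinish c1 = b"
    and c2: "arc c2" "pathstart c2 = a" "pathfinish c2 = b"
    and c3: "arc c3" "pathstart c3 = a" "pathfinish c3 = b"
    and c12: "path_image c1 \<inter> path_image c2 = {a,b}"
    and c13: "path_image c1 \<inter> path_image c3 = {a,b}"
    and c23: "path_image c2 \<inter> path_image c3 = {a,b}"
    and z: "z \<notin> path_image c1 \<union> path_image c2 \<union> path_image c3"
  shows "shields z (path_image c1 \<union> path_image c2) (path_image c3) \<or>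
         shields z (path_image c1 \<union> path_image c3) (path_image c2) \<or>
         shields z (path_image c2 \<union> path_image c3) (path_image c1)"
proof (cases "path_image c3 \<inter> inside (path_image c1 \<union> path_image c2) = {}")
  case False
  then show ?thesis using theta_shields_inside assms by metis
next
  case True
  let ?C = "path_image c1 \<union> path_image c2"
  obtain c where c: "simple_path c" "pathfinish c = pathstart c" "path_image c = ?C"
    using simple_closed_curve_of_arcs[OF c1 c2 c12] by blast
  have "inside ?C \<noteq> {}" "open (inside ?C)" using Jordan_inside_outside[OF c(1,2)] c(3) by auto
  then have "\<not> inside ?C \<subseteq> {z}"
    by (metis finite.emptyI finite_imp_not_open finite_insert finite_subset)
  then obtain w where w: "w \<in> inside ?C" "w \<noteq> z" by blast
  have wC: "w \<notin> path_image c1" "w \<notin> path_image c2" "w \<notin> path_image c3"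
    using w inside_no_overlap[of ?C] True by blast+
  define \<phi> where "\<phi> = (\<lambda>z. inverse (z - w))"
  have inj: "\<phi> x = \<phi> y \<longleftrightarrow> x = y" for x y
    by (simp add: \<phi>_def)
  then have "inj \<phi>" by (simp add: inj_def)
  note mem = inj_image_mem_iff[OF this]
  have disj: "\<phi> ` X \<inter> \<phi> ` Y = {}" if "X \<inter> Y = {}" for X Y
    using that image_Int[OF \<open>inj \<phi>\<close>, of X Y] by simp
  have cont: "continuous_on S \<phi>" if "w \<notin> S" for S
    unfolding \<phi>_def using that by (intro continuous_intros) auto
  have arc': "arc (\<phi> \<circ> g)" if "arc g" "w \<notin> path_image g" for g
    using that cont inj by (auto simp: arc_def path_continuous_image inj_on_def)
  have img: "\<phi> ` X \<inter> \<phi> ` Y = {\<phi> a, \<phi> b}" if "X \<inter> Y = {a,b}" for X Y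
    using that image_Int[of \<phi> X Y] inj by (simp add: inj_on_def)
  have "path_image c3 - {a,b} \<noteq> {}"
    using nonempty_simple_path_endless[OF arc_imp_simple_path[OF c3(1)]] c3 by auto
  then obtain p where p: "p \<in> path_image c3" "p \<noteq> a" "p \<noteq> b" by blast
  then have "p \<notin> ?C" using c13 c23 by blast
  then have "p \<in> outside ?C" using True p inside_Un_outside[of ?C] by blast
  then have "\<phi> p \<in> inside (\<phi> ` ?C)"
    using inversion_swaps_sides[OF c(1,2)] c(3) w by (simp add: \<phi>_def)
  then have m: "path_image (\<phi> \<circ> c3) \<inter> inside (path_image (\<phi> \<circ> c1) \<union> path_image (\<phi> \<circ> c2)) \<noteq> {}"
    using p by (auto simp: path_image_compose image_Un)
  have "shields (\<phi> z) (path_image (\<phi> \<circ> c1) \<union> path_image (\<phi> \<circ> c2)) (path_image (\<phi> \<circ> c3)) \<or>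
         shields (\<phi> z) (path_image (\<phi> \<circ> c1) \<union> path_image (\<phi> \<circ> c3)) (path_image (\<phi> \<circ> c2)) \<or>
         shields (\<phi> z) (path_image (\<phi> \<circ> c2) \<union> path_image (\<phi> \<circ> c3)) (path_image (\<phi> \<circ> c1))"
  proof (rule theta_shields_inside)
    show "\<phi> z \<notin> path_image (\<phi> \<circ> c1) \<union> path_image (\<phi> \<circ> c2) \<union> path_image (\<phi> \<circ> c3)"
      using z inj by (auto simp: path_image_compose)
  qed (use m arc' wC c1 c2 c3 img c12 c13 c23
      in \<open>auto simp: pathstart_compose pathfinish_compose path_image_compose\<close>)
  then have sh: "shields (\<phi> z) (\<phi> ` ?C) (\<phi> ` path_image c3) \<or>
     shields (\<phi> z) (\<phi> ` (path_image c1 \<union> path_image c3)) (\<phi> ` path_image c2) \<or>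
     shields (\<phi> z) (\<phi> ` (path_image c2 \<union> path_image c3)) (\<phi> ` path_image c1)"
    by (simp add: path_image_compose image_Un)
  have pull: "shields z X Z" if sh: "shields (\<phi> z) (\<phi> ` X) (\<phi> ` Z)"
    and X: "closed X" and Z: "w \<notin> Z" for X Z
    unfolding shields_def
  proof (intro allI impI)
    fix S assume S: "connected S \<and> z \<in> S \<and> S \<inter> X = {}"
    \<comment> \<open>A connected set through \<open>w\<close> may fall apart when \<open>w\<close>
      is removed. The open component around it does not, and \<open>w\<close> is not on
      \<open>Z\<close>.\<close>
    define K where "K = connected_component_set (- X) z"
    have K: "open K" "connected K" "K \<inter> X = {}" "S \<subseteq> K"
      using X S open_connected_component[of "-X"] connected_component_subset[of "-X" z]
        connected_component_maximal[of z S "-X"]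
      by (auto simp: K_def)
    have "connected (K - {w})" using K by (intro connected_open_delete) auto
    then have "connected (\<phi> ` (K - {w}))" using cont by (intro connected_continuous_image) auto
    moreover have "\<phi> z \<in> \<phi> ` (K - {w})" using K S w by blast
    moreover have "\<phi> ` (K - {w}) \<inter> \<phi> ` X = {}" using K disj by blast
    ultimately have "\<phi> ` (K - {w}) \<inter> \<phi> ` Z = {}" using sh unfolding shields_def by blast
    then have "(K - {w}) \<inter> Z = {}" by blast
    then show "S \<inter> Z = {}" using Z K by blast
  qed
  have "closed (path_image c1)" "closed (path_image c2)" "closed (path_image c3)"
    using c1 c2 c3 closed_arc_image by auto
  then show ?thesis using sh pull wC by (metis closed_Un)
qed

text \<open>An arc joins the first two points; a path from the third is cut where it first hits the
  arc, and that point is the centre \<open>q\<close>. The legs are sets rather than arcs because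
  they may shrink to a point.\<close>

lemma tripod:
  fixes S :: "complex set" and x :: "nat \<Rightarrow> complex"
  assumes S: "path_connected S" and x: "\<And>j. x j \<in> S"
  obtains q P where "q \<in> S"
    "\<And>j. path_connected (P j) \<and> closed (P j) \<and> P j \<subseteq> S \<and> q \<in> P j"
    "\<And>j. j < 3 \<Longrightarrow> x j \<in> P j"
    "\<And>j k. j < 3 \<Longrightarrow> k < 3 \<Longrightarrow> j \<noteq> k \<Longrightarrow> P j \<inter> P k = {q}"
proof -
  have "\<exists>q P0 P1 P2. q \<in> S \<and> (\<forall>P\<in>{P0, P1, P2}. path_connected P \<and> closed P \<and> P \<subseteq> S \<and> q \<in> P) \<and>
      x 0 \<in> P0 \<and> x 1 \<in> P1 \<and> x 2 \<in> P2 \<and> P0 \<inter> P1 = {q} \<and> P0 \<inter> P2 = {q} \<and> P1 \<inter> P2 = {q}"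
  proof -
    obtain h where h: "path h" "path_image h \<subseteq> S" "pathstart h = x 2" "pathfinish h = x 0"
      using S x unfolding path_connected_def by meson
    have h01: "continuous_on {0..1} h" using h(1) by (simp add: path_def)
    show ?thesis
    \<comment> \<open>An arc needs distinct ends; if they coincide, two of the legs are this single
      point.\<close>
    proof (cases "x 0 = x 1")
      case True
      have "path_connected (path_image h)" "closed (path_image h)" "x 0 \<in> path_image h"
        "x 2 \<in> path_image h"
        using h path_connected_path_image closed_path_image pathfinish_in_path_image
          pathstart_in_path_image by metis+
      then show ?thesis
        using h(2) x[of 0] True
        by (intro exI[of _ "x 0"] exI[of _ "{x 0}"] exI[of _ "path_image h"]) auto
    next
      case False
      then obtain g where g: "arc g" "path_image g \<subseteq> S" "pathstart g = x 0" "pathfinish g = x 1"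
        using S x unfolding path_connected_arcwise by meson
      have g01: "continuous_on {0..1} g" "inj_on g {0..1}"
        using g(1) by (auto simp: arc_def path_def)
      let ?G = "path_image g"
      have "closed ?G" using g(1) closed_arc_image by blast
      then have "closed ({0..1} \<inter> h -` ?G)"
        using h01 by (intro continuous_closed_preimage) auto
      then have "compact ({0..1} \<inter> h -` ?G)"
        by (metis bounded_Int bounded_closed_interval compact_eq_bounded_closed)
      moreover have "1 \<in> {0..1} \<inter> h -` ?G"
        using h(4) g(3) pathstart_in_path_image[of g] by (simp add: pathfinish_def)
      ultimately obtain t where t: "t \<in> {0..1}" "h t \<in> ?G"
          "\<And>s. s \<in> {0..1} \<Longrightarrow> h s \<in> ?G \<Longrightarrow> t \<le> s"
        using compact_attains_inf[of "{0..1} \<inter> h -` ?G"] by (metis IntD1 IntD2 IntI empty_iff vimageD vimageI2)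
      obtain s where s: "s \<in> {0..1}" "g s = h t" using t(2) by (auto simp: path_image_def)
      define q where "q = h t"
      have pc: "path_connected (f ` {u..v}) \<and> closed (f ` {u..v})"
        if "continuous_on {0..1} f" "0 \<le> u" "v \<le> 1" for f :: "real \<Rightarrow> complex" and u v
      proof -
        have "continuous_on {u..v} f" using that by (auto intro: continuous_on_subset)
        then show ?thesis
          by (simp add: compact_continuous_image compact_imp_closed path_connected_continuous_image)
      qed
      have "g ` {0..s} \<inter> g ` {s..1} = g ` ({0..s} \<inter> {s..1})"
        using s by (intro inj_on_image_Int[symmetric, OF g01(2)]) auto
      also have "{0..s} \<inter> {s..1} = {s}" using s by auto
      finally have "g ` {0..s} \<inter> g ` {s..1} = {q}" using s by (simp add: q_def)
      moreover have sub: "g ` {0..s} \<subseteq> ?G" "g ` {s..1} \<subseteq> ?G" "h ` {0..t} \<subseteq> path_image h"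
        using s t by (auto simp: path_image_def)
      moreover have hG: "h ` {0..t} \<inter> ?G \<subseteq> {q}"
      proof
        fix y assume "y \<in> h ` {0..t} \<inter> ?G"
        then obtain r where r: "r \<in> {0..t}" "y = h r" "h r \<in> ?G" by blast
        then have "r = t" using t(1) t(3)[of r] by auto
        then show "y \<in> {q}" using r by (simp add: q_def)
      qed
      moreover have q: "q \<in> g ` {0..s}" "q \<in> g ` {s..1}" "q \<in> h ` {0..t}"
        using s t by (auto simp: q_def intro: rev_image_eqI)
      moreover have "x 0 \<in> g ` {0..s}" "x 1 \<in> g ` {s..1}" "x 2 \<in> h ` {0..t}"
        using s t g(3,4) h(3) by (force simp: pathstart_def pathfinish_def)+
      moreover have "g ` {0..s} \<inter> h ` {0..t} = {q}" "g ` {s..1} \<inter> h ` {0..t} = {q}"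
        using hG sub q by blast+
      moreover have "\<forall>P\<in>{g ` {0..s}, g ` {s..1}, h ` {0..t}}. path_connected P \<and> closed P \<and> P \<subseteq> S \<and> q \<in> P"
        using pc[OF g01(1), of 0 s] pc[OF g01(1), of s 1] pc[OF h01, of 0 t] s(1) t(1)
          order_trans[OF sub(1) g(2)] order_trans[OF sub(2) g(2)] order_trans[OF sub(3) h(2)] q by simp
      moreover have "q \<in> S" using t(2) g(2) by (auto simp: q_def)
      ultimately show ?thesis
        by (intro exI[of _ q] exI[of _ "g ` {0..s}"] exI[of _ "g ` {s..1}"] exI[of _ "h ` {0..t}"] conjI)
    qed
  qed
  then obtain q P0 P1 P2 where *: "q \<in> S"
      "\<forall>P\<in>{P0, P1, P2}. path_connected P \<and> closed P \<and> P \<subseteq> S \<and> q \<in> P"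
      "x 0 \<in> P0" "x 1 \<in> P1" "x 2 \<in> P2" "P0 \<inter> P1 = {q}" "P0 \<inter> P2 = {q}" "P1 \<inter> P2 = {q}"
    by auto
  have lt3: "j = 0 \<or> j = 1 \<or> j = 2" if "j < 3" for j :: nat using that by auto
  define P where "P = (\<lambda>j::nat. if j = 0 then P0 else if j = 1 then P1 else P2)"
  have P: "P 0 = P0" "P 1 = P1" "P 2 = P2" by (auto simp: P_def)
  have 1: "path_connected (P j) \<and> closed (P j) \<and> P j \<subseteq> S \<and> q \<in> P j" for j
    using *(2) by (auto simp: P_def)
  have 2: "x j \<in> P j" if "j < 3" for j
    using lt3[OF that] * P by metis
  have 3: "P j \<inter> P k = {q}" if "j < 3" "k < 3" "j \<noteq> k" for j k
    using lt3[OF that(1)] lt3[OF that(2)] that(3) *(6-8) P Int_commute by metis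
  show thesis using that[OF *(1) 1 2 3] .
qed

text \<open>Tripods in \<open>\<alpha> 0\<close> and \<open>\<alpha> 1\<close> have centres
  \<open>a\<close> and \<open>b\<close>; routing through each \<open>\<beta> j\<close> gives three
  arcs between them, a theta curve. From a point of \<open>\<alpha> 2\<close>, the connected set
  \<alpha> 2 \<union> \<beta> j reaches the arc through \<open>\<beta> j\<close> and avoids the
  other two, against \<open>theta_shields\<close>. The sets \<open>\<beta> j\<close> touch
  \<open>\<alpha> i\<close> at \<open>x i j\<close> without containing it, which keeps all six sets
  disjoint.\<close>

lemma no_plane_K33:
  fixes \<alpha> \<beta> :: "nat \<Rightarrow> complex set" and x :: "nat \<Rightarrow> nat \<Rightarrow> complex"
  assumes \<alpha>: "\<And>i. i < 3 \<Longrightarrow> path_connected (\<alpha> i)"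
    and \<beta>: "\<And>j. j < 3 \<Longrightarrow> path_connected (\<beta> j)" "\<And>j. j < 3 \<Longrightarrow> \<beta> j \<noteq> {}"
    and \<alpha>\<alpha>: "\<And>i i'. i < 3 \<Longrightarrow> i' < 3 \<Longrightarrow> i \<noteq> i' \<Longrightarrow> \<alpha> i \<inter> \<alpha> i' = {}"
    and \<beta>\<beta>: "\<And>j j'. j < 3 \<Longrightarrow> j' < 3 \<Longrightarrow> j \<noteq> j' \<Longrightarrow> \<beta> j \<inter> \<beta> j' = {}"
    and \<alpha>\<beta>: "\<And>i j. i < 3 \<Longrightarrow> j < 3 \<Longrightarrow> \<alpha> i \<inter> \<beta> j = {}"
    and x: "\<And>i j. i < 3 \<Longrightarrow> j < 3 \<Longrightarrow> x i j \<in> \<alpha> i"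
      "\<And>i j. i < 3 \<Longrightarrow> j < 3 \<Longrightarrow> path_connected (insert (x i j) (\<beta> j))"
  shows False
proof -
  define legs where "legs = (\<lambda>i q P. q \<in> \<alpha> i \<and>
      (\<forall>j. path_connected (P j) \<and> closed (P j) \<and> P j \<subseteq> \<alpha> i \<and> q \<in> P j) \<and>
      (\<forall>j<3. x i j \<in> P j) \<and> (\<forall>j<3. \<forall>k<3. j \<noteq> k \<longrightarrow> P j \<inter> P k = {q}))"
  have ex_legs: "\<exists>q P. legs i q P" if i: "i < 3" for i
  proof -
    \<comment> \<open>\<open>tripod\<close> expects a point for every natural number; indices from 3
      on are padded.\<close>
    define x' where "x' = (\<lambda>j::nat. if j < 3 then x i j else x i 0)"
    have x': "x' j \<in> \<alpha> i" for j using x(1) that by (auto simp: x'_def)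
    obtain q P where "q \<in> \<alpha> i"
        "\<And>j. path_connected (P j) \<and> closed (P j) \<and> P j \<subseteq> \<alpha> i \<and> q \<in> P j"
        "\<And>j. j < 3 \<Longrightarrow> x' j \<in> P j"
        "\<And>j k. j < 3 \<Longrightarrow> k < 3 \<Longrightarrow> j \<noteq> k \<Longrightarrow> P j \<inter> P k = {q}"
      by (rule tripod[OF \<alpha>[OF i], of x', OF x']) (rule that; assumption)
    then show ?thesis unfolding x'_def legs_def by (intro exI[of _ q] exI[of _ P]) auto
  qed
  obtain a P where "legs 0 a P" using ex_legs[of 0] by auto
  then have a: "a \<in> \<alpha> 0" and P: "path_connected (P j)" "closed (P j)" "P j \<subseteq> \<alpha> 0" "a \<in> P j"
      "j < 3 \<Longrightarrow> x 0 j \<in> P j" "j < 3 \<Longrightarrow> k < 3 \<Longrightarrow> j \<noteq> k \<Longrightarrow> P j \<inter> P k = {a}" for j k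
    unfolding legs_def by simp_all
  obtain b Q where "legs 1 b Q" using ex_legs[of 1] by auto
  then have b: "b \<in> \<alpha> 1" and Q: "path_connected (Q j)" "closed (Q j)" "Q j \<subseteq> \<alpha> 1" "b \<in> Q j"
      "j < 3 \<Longrightarrow> x 1 j \<in> Q j" "j < 3 \<Longrightarrow> k < 3 \<Longrightarrow> j \<noteq> k \<Longrightarrow> Q j \<inter> Q k = {b}" for j k
    unfolding legs_def by simp_all
  have ab: "a \<noteq> b" "\<alpha> 0 \<inter> \<alpha> 1 = {}" using a b \<alpha>\<alpha>[of 0 1] by auto
  define U where "U = (\<lambda>j. P j \<union> \<beta> j \<union> Q j)"
  have U: "path_connected (U j)" if "j < 3" for j
  proof -
    have "path_connected (P j \<union> insert (x 0 j) (\<beta> j))"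
      using P x that by (intro path_connected_Un) auto
    then have "path_connected ((P j \<union> insert (x 0 j) (\<beta> j)) \<union> (insert (x 1 j) (\<beta> j) \<union> Q j))"
      using Q x that \<beta>(2)[OF that]
      by (intro path_connected_Un[OF _ path_connected_Un]) auto
    moreover have "(P j \<union> insert (x 0 j) (\<beta> j)) \<union> (insert (x 1 j) (\<beta> j) \<union> Q j) = U j"
      using P(5) Q(5) that by (auto simp: U_def)
    ultimately show ?thesis by simp
  qed
  have "\<exists>c. arc c \<and> path_image c \<subseteq> U j \<and> pathstart c = a \<and> pathfinish c = b" if "j < 3" for j
    using U[OF that] ab(1) P(4)[of j] Q(4)[of j] unfolding path_connected_arcwise
    by (simp add: U_def)
  then obtain c where c: "\<And>j. j < 3 \<Longrightarrow> arc (c j)" "\<And>j. j < 3 \<Longrightarrow> path_image (c j) \<subseteq> U j"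
      "\<And>j. j < 3 \<Longrightarrow> pathstart (c j) = a" "\<And>j. j < 3 \<Longrightarrow> pathfinish (c j) = b"
    by (metis (no_types, lifting))
  have ends: "a \<in> path_image (c j)" "b \<in> path_image (c j)" if "j < 3" for j
    using c that pathstart_in_path_image pathfinish_in_path_image by metis+
  have UU: "U j \<inter> U k \<subseteq> {a,b}" if "j < 3" "k < 3" "j \<noteq> k" for j k
  proof
    fix y assume "y \<in> U j \<inter> U k"
    then have y: "y \<in> P j \<or> y \<in> \<beta> j \<or> y \<in> Q j" "y \<in> P k \<or> y \<in> \<beta> k \<or> y \<in> Q k"
      by (auto simp: U_def)
    have "y \<in> P j \<or> y \<in> P k \<longrightarrow> y \<in> \<alpha> 0" "y \<in> Q j \<or> y \<in> Q k \<longrightarrow> y \<in> \<alpha> 1" using P(3) Q(3) by blast+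
    moreover have "\<not> (y \<in> \<alpha> 0 \<and> y \<in> \<beta> j)" "\<not> (y \<in> \<alpha> 0 \<and> y \<in> \<beta> k)" "\<not> (y \<in> \<alpha> 1 \<and> y \<in> \<beta> j)"
      "\<not> (y \<in> \<alpha> 1 \<and> y \<in> \<beta> k)" "\<not> (y \<in> \<beta> j \<and> y \<in> \<beta> k)" "\<not> (y \<in> \<alpha> 0 \<and> y \<in> \<alpha> 1)"
      using \<alpha>\<beta>[of 0 j] \<alpha>\<beta>[of 0 k] \<alpha>\<beta>[of 1 j] \<alpha>\<beta>[of 1 k] \<beta>\<beta>[OF that] ab(2) that by auto
    moreover have "y \<in> P j \<and> y \<in> P k \<longrightarrow> y = a" "y \<in> Q j \<and> y \<in> Q k \<longrightarrow> y = b"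
      using P(6)[OF that] Q(6)[OF that] by blast+
    ultimately show "y \<in> {a, b}" using y by blast
  qed
  have cc: "path_image (c j) \<inter> path_image (c k) = {a,b}" if "j < 3" "k < 3" "j \<noteq> k" for j k
    using UU[OF that] c(2)[of j] c(2)[of k] ends[of j] ends[of k] that by blast
  \<comment> \<open>Here the legs must be closed: a connected arc from \<open>a\<close> to
    \<open>b\<close> cannot be covered by two disjoint closed legs.\<close>
  have c\<beta>: "path_image (c j) \<inter> \<beta> j \<noteq> {}" if "j < 3" for j
  proof
    assume "path_image (c j) \<inter> \<beta> j = {}"
    then have "path_image (c j) \<subseteq> P j \<union> Q j" using c(2)[OF that] by (auto simp: U_def)
    moreover have "connected (path_image (c j))"
      using c(1)[OF that] by (simp add: connected_arc_image)
    moreover have "P j \<inter> Q j \<inter> path_image (c j) = {}" using P(3)[of j] Q(3)[of j] ab(2) by blast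
    ultimately have "P j \<inter> path_image (c j) = {} \<or> Q j \<inter> path_image (c j) = {}"
      using P(2) Q(2) by (intro connected_closedD)
    then show False using P(4)[of j] Q(4)[of j] ends[OF that] by blast
  qed
  obtain z where z: "z \<in> \<alpha> 2" using x(1)[of 2 0] by auto
  define S where "S = (\<lambda>j. \<alpha> 2 \<union> \<beta> j)"
  have S: "connected (S j)" if "j < 3" for j
  proof -
    have "path_connected (\<alpha> 2 \<union> insert (x 2 j) (\<beta> j))"
      using \<alpha>[of 2] x[of 2 j] that by (intro path_connected_Un) auto
    moreover have "\<alpha> 2 \<union> insert (x 2 j) (\<beta> j) = S j"
      using x(1)[of 2 j] that by (auto simp: S_def)
    ultimately show ?thesis using path_connected_imp_connected by metis
  qed
  have Sc: "S j \<inter> path_image (c k) = {}" if "j < 3" "k < 3" "j \<noteq> k" for j k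
  proof -
    have "\<alpha> 2 \<inter> \<alpha> 0 = {}" "\<alpha> 2 \<inter> \<alpha> 1 = {}" using \<alpha>\<alpha> by auto
    moreover have "\<alpha> 2 \<inter> \<beta> k = {}" "\<alpha> 0 \<inter> \<beta> j = {}" "\<alpha> 1 \<inter> \<beta> j = {}" using \<alpha>\<beta> that by auto
    moreover have "\<beta> j \<inter> \<beta> k = {}" using \<beta>\<beta>[OF that] .
    moreover have "S j \<inter> U k \<subseteq> (\<alpha> 2 \<union> \<beta> j) \<inter> (\<alpha> 0 \<union> \<beta> k \<union> \<alpha> 1)"
      using P(3)[of k] Q(3)[of k] by (auto simp: S_def U_def)
    ultimately have "S j \<inter> U k = {}" by (auto simp: Int_Un_distrib Int_Un_distrib2 Int_commute)
    then show ?thesis using c(2)[OF that(2)] by blast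
  qed
  have zc: "z \<notin> path_image (c k)" if "k < 3" for k
  proof -
    obtain j :: nat where "j < 3" "j \<noteq> k" by (cases "k = 0") (auto intro: that[of 0] that[of 1])
    then show ?thesis using Sc[of j k] that z by (auto simp: S_def)
  qed
  have sh: "\<not> shields z (path_image (c k) \<union> path_image (c l)) (path_image (c j))"
    if "j < 3" "k < 3" "l < 3" "j \<noteq> k" "j \<noteq> l" for j k l
  proof
    assume "shields z (path_image (c k) \<union> path_image (c l)) (path_image (c j))"
    then have "S j \<inter> path_image (c j) = {}"
      using S[OF that(1)] Sc[of j k] Sc[of j l] that z unfolding shields_def
      by (metis Int_Un_distrib S_def UnI1 sup_bot.right_neutral)
    then show False using c\<beta>[OF that(1)] by (auto simp: S_def)
  qed
  have "(0::nat) < 3" "(1::nat) < 3" "(2::nat) < 3" by auto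
  then show False
    using theta_shields[of "c 0" a b "c 1" "c 2" z] c cc[of 0 1] cc[of 0 2] cc[of 1 2] zc
      sh[of 2 0 1] sh[of 1 0 2] sh[of 0 1 2] by simp
qed

subsection \<open>Minors of planar graphs\<close>

lemma path_connected_half_open_arc:
  fixes g :: "real \<Rightarrow> complex"
  assumes "arc g" "a = pathstart g \<or> a = pathfinish g"
  shows "path_connected (path_image g - {a})"
proof -
  have g: "continuous_on {0..1} g" "inj_on g {0..1}" using assms(1) by (auto simp: arc_def path_def)
  have pc: "path_connected (g ` I)" if "is_interval I" "I \<subseteq> {0..1}" for I
    using that g(1) continuous_on_subset
    by (metis is_interval_path_connected path_connected_continuous_image)
  have "g ` {0..1} - {g 0} = g ` ({0..1} - {0})" "g ` {0..1} - {g 1} = g ` ({0..1} - {1})"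
    using inj_on_image_set_diff[OF g(2)] by (metis Diff_subset atLeastAtMost_iff empty_subsetI
        image_empty image_insert insert_subset order_refl zero_le_one)+
  moreover have "{0..1} - {0} = {0<..1::real}" "{0..1} - {1} = {0..<1::real}" by auto
  ultimately show ?thesis
    using assms(2) pc[of "{0<..1}"] pc[of "{0..<1}"]
    by (auto simp: pathstart_def pathfinish_def path_image_def is_interval_oc is_interval_co
        greaterThanAtMost_subseteq_atLeastAtMost_iff atLeastLessThan_subseteq_atLeastAtMost_iff)
qed

section \<open>Connected vertex sets in a plane drawing\<close>

locale drawing =
  fixes H :: "'a sgraph" and p :: "'a \<Rightarrow> complex" and \<gamma> :: "'a set \<Rightarrow> real \<Rightarrow> complex"
  assumes simple: "simple_graph H"
    and inj: "inj_on p (verts H)"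
    and arc: "\<And>e. e \<in> edges H \<Longrightarrow> arc (\<gamma> e)"
    and ends: "\<And>e. e \<in> edges H \<Longrightarrow> {pathstart (\<gamma> e), pathfinish (\<gamma> e)} = p ` e"
    and avoid: "\<And>e. e \<in> edges H \<Longrightarrow> path_image (\<gamma> e) \<inter> p ` verts H = p ` e"
    and cross: "\<And>e f. e \<in> edges H \<Longrightarrow> f \<in> edges H \<Longrightarrow> e \<noteq> f \<Longrightarrow>
      path_image (\<gamma> e) \<inter> path_image (\<gamma> f) = p ` (e \<inter> f)"
begin

definition trace :: "'a set \<Rightarrow> complex set" where
  "trace A = p ` A \<union> (\<Union>e\<in>{e \<in> edges H. e \<subseteq> A}. path_image (\<gamma> e))"

lemma edge_subset: "e \<in> edges H \<Longrightarrow> e \<subseteq> verts H" "e \<in> edges H \<Longrightarrow> e \<noteq> {}"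
  using simple by (force simp: simple_graph_def)+

lemma p_image_Int: "A \<subseteq> verts H \<Longrightarrow> B \<subseteq> verts H \<Longrightarrow> p ` A \<inter> p ` B = p ` (A \<inter> B)"
  using inj_on_image_Int[OF inj] by metis

text \<open>An edge not contained in \<open>A\<close> differs from every edge drawn in the trace, so
  the two arcs share images of common ends only.\<close>

lemma arc_Int_trace:
  assumes e: "e \<in> edges H" and A: "A \<subseteq> verts H" "\<not> e \<subseteq> A"
  shows "path_image (\<gamma> e) \<inter> trace A \<subseteq> p ` (e \<inter> A)"
proof -
  have "path_image (\<gamma> e) \<inter> p ` A \<subseteq> p ` (e \<inter> A)"
    using avoid[OF e] p_image_Int[OF edge_subset(1)[OF e] A(1)] A(1) by blast
  moreover have "path_image (\<gamma> e) \<inter> path_image (\<gamma> f) \<subseteq> p ` (e \<inter> A)" if "f \<in> edges H" "f \<subseteq> A" for f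
    using cross[OF e that(1)] that A(2) by blast
  ultimately show ?thesis unfolding trace_def by blast
qed

lemma trace_disjoint:
  assumes "A \<subseteq> verts H" "B \<subseteq> verts H" "A \<inter> B = {}"
  shows "trace A \<inter> trace B = {}"
proof -
  have "p ` A \<inter> p ` B = {}" using p_image_Int[OF assms(1,2)] assms(3) by simp
  moreover have "path_image (\<gamma> e) \<inter> trace B = {}" if "e \<in> edges H" "e \<subseteq> A" for e
    using arc_Int_trace[OF that(1) assms(2)] that edge_subset[OF that(1)] assms by blast
  moreover have "path_image (\<gamma> e) \<inter> trace A = {}" if "e \<in> edges H" "e \<subseteq> B" for e
    using arc_Int_trace[OF that(1) assms(1)] that edge_subset[OF that(1)] assms by blast
  ultimately show ?thesis unfolding trace_def by blast
qed

lemma arc_ends_in: "e \<in> edges H \<Longrightarrow> x \<in> e \<Longrightarrow> p x \<in> path_image (\<gamma> e)"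
  using avoid by blast

lemma path_connected_arc: "e \<in> edges H \<Longrightarrow> path_connected (path_image (\<gamma> e))"
  using arc by (simp add: arc_imp_path path_connected_path_image)

lemma path_connected_trace:
  assumes "conn (adjacency H) A"
  shows "path_connected (trace A)"
proof -
  have arcs: "path_component (trace A) s t"
    if "e \<in> edges H" "e \<subseteq> A" "s \<in> path_image (\<gamma> e)" "t \<in> path_image (\<gamma> e)" for e s t
  proof -
    have "path_component (path_image (\<gamma> e)) s t"
      using path_connected_arc that path_connected_component by blast
    then show ?thesis by (rule path_component_of_subset[rotated]) (use that in \<open>auto simp: trace_def\<close>)
  qed
  have pts: "path_component (trace A) (p x) (p y)" if xy: "x \<in> A" "y \<in> A" for x y
  proof -
    have "(x, y) \<in> (adjacency H \<inter> A \<times> A)\<^sup>*" using assms xy by (auto simp: conn_def)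
    then show ?thesis
    proof (induction rule: rtrancl_induct)
      case base
      then show ?case using xy by (simp add: path_component_refl trace_def)
    next
      case (step y z)
      then have "path_component (trace A) (p y) (p z)"
        by (intro arcs[of "{y, z}"] arc_ends_in) (auto simp: adjacency_def)
      with step.IH show ?case by (rule path_component_trans)
    qed
  qed
  have near: "\<exists>x\<in>A. path_component (trace A) s (p x)" if "s \<in> trace A" for s
  proof -
    from that consider x where "x \<in> A" "s = p x" | e where "e \<in> edges H" "e \<subseteq> A" "s \<in> path_image (\<gamma> e)"
      unfolding trace_def by blast
    then show ?thesis
    proof cases
      case 1
      then show ?thesis using pts by blast
    next
      case 2
      then obtain x where "x \<in> e" using edge_subset by blast
      then show ?thesis using 2 arcs arc_ends_in by blast
    qed
  qed
  show ?thesis unfolding path_connected_component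
    using near pts by (meson path_component_sym path_component_trans)
qed

text \<open>One edge is chosen between each \<open>A i\<close> and each \<open>B j\<close>. Its arc,
  without the end in \<open>A i\<close>, is added to the trace of \<open>B j\<close>; the removed
  end is the point at which the enlarged set touches the trace of \<open>A i\<close>.\<close>

lemma no_K33_minor:
  fixes A B :: "nat \<Rightarrow> 'a set"
  assumes A: "\<And>i. i < 3 \<Longrightarrow> A i \<subseteq> verts H" "\<And>i. i < 3 \<Longrightarrow> conn (adjacency H) (A i)"
    and B: "\<And>j. j < 3 \<Longrightarrow> B j \<subseteq> verts H" "\<And>j. j < 3 \<Longrightarrow> conn (adjacency H) (B j)"
    and AA: "\<And>i i'. i < 3 \<Longrightarrow> i' < 3 \<Longrightarrow> i \<noteq> i' \<Longrightarrow> A i \<inter> A i' = {}"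
    and BB: "\<And>j j'. j < 3 \<Longrightarrow> j' < 3 \<Longrightarrow> j \<noteq> j' \<Longrightarrow> B j \<inter> B j' = {}"
    and AB: "\<And>i j. i < 3 \<Longrightarrow> j < 3 \<Longrightarrow> A i \<inter> B j = {}"
    and e: "\<And>i j. i < 3 \<Longrightarrow> j < 3 \<Longrightarrow> \<exists>x\<in>A i. \<exists>y\<in>B j. (x, y) \<in> adjacency H"
  shows False
proof -
  obtain x y where xy: "\<And>i j. i < 3 \<Longrightarrow> j < 3 \<Longrightarrow> x i j \<in> A i"
      "\<And>i j. i < 3 \<Longrightarrow> j < 3 \<Longrightarrow> y i j \<in> B j"
      "\<And>i j. i < 3 \<Longrightarrow> j < 3 \<Longrightarrow> {x i j, y i j} \<in> edges H"
    using e unfolding adjacency_def by simp metis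
  define g where "g = (\<lambda>i j. path_image (\<gamma> {x i j, y i j}))"
  define L where "L = (\<lambda>i j. g i j - {p (x i j)})"
  define \<beta> where "\<beta> = (\<lambda>j. trace (B j) \<union> (\<Union>i\<in>{..<3}. L i j))"
  have ne: "x i j \<notin> B j" "y i j \<notin> A i" if "i < 3" "j < 3" for i j
    using AB[OF that] xy(1,2)[OF that] by auto
  have pne: "p (x i j) \<noteq> p (y i j)" if "i < 3" "j < 3" for i j
    using inj xy(1,2)[OF that] ne[OF that] A(1)[OF that(1)] B(1)[OF that(2)]
    by (metis inj_on_contraD subsetD)
  have ying: "p (y i j) \<in> g i j" "p (x i j) \<in> g i j" if "i < 3" "j < 3" for i j
    using xy(3)[OF that] arc_ends_in by (auto simp: g_def)
  have yin: "p (y i j) \<in> trace (B j)" "p (x i j) \<in> trace (A i)" if "i < 3" "j < 3" for i j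
    using xy(1,2)[OF that] by (auto simp: trace_def)
  have pcL: "path_connected (L i j)" if "i < 3" "j < 3" for i j
    unfolding L_def g_def using arc[OF xy(3)[OF that]] ends[OF xy(3)[OF that]]
    by (intro path_connected_half_open_arc) auto
  have pcTL: "path_connected (trace (B j) \<union> L i j)" if "i < 3" "j < 3" for i j
    using path_connected_trace[OF B(2)[OF that(2)]] pcL[OF that] yin(1)[OF that] ying(1)[OF that] pne[OF that]
    by (intro path_connected_Un) (auto simp: L_def)
  have pc\<beta>: "path_connected (\<beta> j)" if "j < 3" for j
  proof -
    have "path_connected ((trace (B j) \<union> L 0 j) \<union> ((trace (B j) \<union> L 1 j) \<union> (trace (B j) \<union> L 2 j)))"
      using pcTL[of 0 j] pcTL[of 1 j] pcTL[of 2 j] yin(1)[of 0 j] that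
      by (intro path_connected_Un[of "trace (B j) \<union> L 0 j"] path_connected_Un[of "trace (B j) \<union> L 1 j"]) auto
    moreover have "{..<3::nat} = {0, 1, 2}" by auto
    then have "(trace (B j) \<union> L 0 j) \<union> ((trace (B j) \<union> L 1 j) \<union> (trace (B j) \<union> L 2 j)) = \<beta> j"
      by (auto simp: \<beta>_def)
    ultimately show ?thesis by simp
  qed
  have gA: "g i j \<inter> trace (A k) \<subseteq> {p (x i j)}" if "i < 3" "j < 3" "k < 3" for i j k
  proof -
    have "y i j \<notin> A k" using AB[OF that(3,2)] xy(2)[OF that(1,2)] by blast
    then show ?thesis
      using arc_Int_trace[OF xy(3)[OF that(1,2)] A(1)[OF that(3)]] by (auto simp: g_def)
  qed
  have gB: "g i j \<inter> trace (B k) = {}" if "i < 3" "j < 3" "k < 3" "k \<noteq> j" for i j k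
  proof -
    have "y i j \<notin> B k" "x i j \<notin> B k"
      using AB[OF that(1,3)] BB[OF that(3,2,4)] xy(1,2)[OF that(1,2)] by blast+
    then show ?thesis
      using arc_Int_trace[OF xy(3)[OF that(1,2)] B(1)[OF that(3)]] by (auto simp: g_def)
  qed
  \<comment> \<open>Arcs chosen for different \<open>j\<close> can share only an end on the
    \<open>A\<close> side, and this end has been removed.\<close>
  have LL: "L i j \<inter> L k l = {}" if "i < 3" "j < 3" "k < 3" "l < 3" "j \<noteq> l" for i j k l
  proof -
    have y: "y i j \<notin> {x k l, y k l}" "y k l \<notin> {x i j, y i j}"
      using BB[OF that(2,4,5)] AB[OF that(3,2)] AB[OF that(1,4)] xy(1,2)[OF that(1,2)] xy(1,2)[OF that(3,4)]
      by auto
    then have "g i j \<inter> g k l = p ` ({x i j, y i j} \<inter> {x k l, y k l})"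
      unfolding g_def by (intro cross xy that) auto
    also have "\<dots> \<subseteq> {p (x i j)}" using y by auto
    finally show ?thesis
      using y \<open>g i j \<inter> g k l = p ` ({x i j, y i j} \<inter> {x k l, y k l})\<close> by (auto simp: L_def)
  qed
  show False
  proof (rule no_plane_K33[of "\<lambda>i. trace (A i)" \<beta> "\<lambda>i j. p (x i j)"])
    fix i :: nat assume i: "i < 3"
    show "path_connected (trace (A i))" using path_connected_trace A(2) i by blast
    fix j :: nat assume j: "j < 3"
    show "p (x i j) \<in> trace (A i)" using yin i j by blast
    show "trace (A i) \<inter> \<beta> j = {}"
      using trace_disjoint[OF A(1)[OF i] B(1)[OF j] AB[OF i j]] gA[OF _ j i]
      unfolding \<beta>_def L_def by blast
    have "path_connected (\<beta> j \<union> g i j)"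
      using pc\<beta>[OF j] path_connected_arc[OF xy(3)[OF i j]] ying(1)[OF i j] yin(1)[OF i j]
      unfolding g_def by (intro path_connected_Un) (auto simp: \<beta>_def)
    moreover have "\<beta> j \<union> g i j = insert (p (x i j)) (\<beta> j)"
      using ying(2)[OF i j] i by (auto simp: \<beta>_def L_def)
    ultimately show "path_connected (insert (p (x i j)) (\<beta> j))" by simp
  next
    fix j :: nat assume "j < 3"
    then show "\<beta> j \<noteq> {}" using yin(1)[of 0 j] by (auto simp: \<beta>_def)
  next
    fix i i' :: nat assume "i < 3" "i' < 3" "i \<noteq> i'"
    then show "trace (A i) \<inter> trace (A i') = {}" using trace_disjoint A(1) AA by simp
  next
    fix j j' :: nat assume j: "j < 3" "j' < 3" "j \<noteq> j'"
    have "trace (B j) \<inter> trace (B j') = {}" using j trace_disjoint B(1) BB by simp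
    moreover have "L i j \<inter> trace (B j') = {}" "L i j' \<inter> trace (B j) = {}" if "i < 3" for i
      using gB[of i j j'] gB[of i j' j] that j unfolding L_def by auto
    moreover have "L i j \<inter> L k j' = {}" if "i < 3" "k < 3" for i k
      using LL[of i j k j'] that j by blast
    ultimately show "\<beta> j \<inter> \<beta> j' = {}"
      unfolding \<beta>_def disjoint_iff by auto
  qed (use pc\<beta> in auto)
qed

end

section \<open>Models of minors and Mader's theorem\<close>

definition branch_family :: "('a \<times> 'a) set \<Rightarrow> 'a set set \<Rightarrow> bool" where
  "branch_family E P \<longleftrightarrow> finite P \<and> disjoint P \<and> (\<forall>A\<in>P. A \<noteq> {} \<and> conn E A)"

text \<open>Ordered pairs: with a symmetric \<open>E\<close>, each edge of the minor counts
  twice.\<close>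

definition links :: "('a \<times> 'a) set \<Rightarrow> 'a set set \<Rightarrow> ('a set \<times> 'a set) set" where
  "links E P = {(A, B). A \<in> P \<and> B \<in> P \<and> A \<noteq> B \<and> (\<exists>x\<in>A. \<exists>y\<in>B. (x, y) \<in> E)}"

text \<open>The second clause preserves adjacency: a set linked to every member of \<open>P\<close>
  and disjoint from the members of \<open>Q\<close> is linked to every member of
  \<open>Q\<close>.\<close>

definition coarsens :: "'a set set \<Rightarrow> 'a set set \<Rightarrow> bool" where
  "coarsens Q P \<longleftrightarrow> \<Union>Q \<subseteq> \<Union>P \<and> (\<forall>q\<in>Q. \<exists>p\<in>P. p \<subseteq> q)"

lemma coarsens_refl: "coarsens P P"
  by (auto simp: coarsens_def)

lemma coarsens_trans:
  assumes "coarsens R Q" "coarsens Q P"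
  shows "coarsens R P"
  unfolding coarsens_def
proof (intro conjI ballI)
  show "\<Union>R \<subseteq> \<Union>P"
    using assms order_trans[of "\<Union>R" "\<Union>Q" "\<Union>P"] by (simp add: coarsens_def)
  fix r assume "r \<in> R"
  then obtain q where "q \<in> Q" "q \<subseteq> r" using assms(1) by (auto simp: coarsens_def)
  moreover from this obtain p where "p \<in> P" "p \<subseteq> q" using assms(2) by (auto simp: coarsens_def)
  ultimately show "\<exists>p\<in>P. p \<subseteq> r" using order_trans by blast
qed

lemma coarsens_subset:
  assumes "N \<subseteq> Q" "coarsens Q P"
  shows "coarsens N P"
  unfolding coarsens_def
proof (intro conjI ballI)
  show "\<Union>N \<subseteq> \<Union>P"
    using assms(2) order_trans[OF Union_mono[OF assms(1)]] by (simp add: coarsens_def)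
qed (use assms in \<open>auto simp: coarsens_def\<close>)

lemma finite_links: "finite P \<Longrightarrow> finite (links E P)"
  by (rule finite_subset[of _ "P \<times> P"]) (auto simp: links_def)

lemma links_sym: "sym E \<Longrightarrow> (A, B) \<in> links E P \<Longrightarrow> (B, A) \<in> links E P"
  by (auto simp: links_def dest: symD)

lemma branch_family_subset: "branch_family E Q \<Longrightarrow> N \<subseteq> Q \<Longrightarrow> branch_family E N"
  unfolding branch_family_def by (auto dest: finite_subset pairwise_subset)

lemma branch_family_Int: "branch_family E Q \<Longrightarrow> A \<in> Q \<Longrightarrow> B \<in> Q \<Longrightarrow> A \<noteq> B \<Longrightarrow> A \<inter> B = {}"
  by (simp add: branch_family_def disjoint_def)

lemma branch_family_nonempty: "branch_family E Q \<Longrightarrow> A \<in> Q \<Longrightarrow> A \<noteq> {}"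
  by (simp add: branch_family_def)

lemma branch_family_insert:
  assumes "branch_family E Q" "A \<noteq> {}" "conn E A" "A \<inter> \<Union>Q = {}"
  shows "branch_family E (insert A Q)"
proof -
  have "disjoint (insert A Q)"
    using assms(1,4) by (intro pairwise_insert[THEN iffD2]) (auto simp: branch_family_def disjnt_def)
  then show ?thesis using assms by (simp add: branch_family_def)
qed

lemma branch_family_contract:
  assumes E: "sym E" and Q: "branch_family E Q" and AB: "(A, B) \<in> links E Q"
  shows "branch_family E (insert (A \<union> B) (Q - {A, B}))"
proof -
  from AB have A: "A \<in> Q" "B \<in> Q" "A \<noteq> B" and xy: "\<exists>x\<in>A. \<exists>y\<in>B. (x, y) \<in> E"
    by (auto simp: links_def)
  have "conn E (A \<union> B)" using xy conn_join[OF E] Q A by (auto simp: branch_family_def)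
  moreover have "(A \<union> B) \<inter> \<Union>(Q - {A, B}) = {}"
    using branch_family_Int[OF Q A(1)] branch_family_Int[OF Q A(2)] by blast
  moreover have "A \<union> B \<noteq> {}" using branch_family_nonempty[OF Q A(1)] by blast
  ultimately show ?thesis using branch_family_subset[OF Q, of "Q - {A, B}"]
    by (intro branch_family_insert) auto
qed

text \<open>A contraction loses the two orders of the contracted link and, for every common
  neighbour, the two orders of one of a pair of links that become equal. The set \<open>R\<close>
  collects these; off \<open>R\<close> the renaming \<open>f\<close> is injective on links.\<close>

lemma card_links_contract:
  assumes E: "sym E" and Q: "branch_family E Q" and AB: "(A, B) \<in> links E Q"
  shows "card (links E Q) \<le> card (links E (insert (A \<union> B) (Q - {A, B}))) + 2
    + 2 * card {C. (A, C) \<in> links E Q \<and> (B, C) \<in> links E Q}"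
proof -
  let ?Q = "insert (A \<union> B) (Q - {A, B})" and ?C = "{C. (A, C) \<in> links E Q \<and> (B, C) \<in> links E Q}"
  from AB have A: "A \<in> Q" "B \<in> Q" "A \<noteq> B" by (auto simp: links_def)
  have fin: "finite Q" "finite (links E Q)" using Q finite_links by (auto simp: branch_family_def)
  have new: "A \<union> B \<notin> Q - {A, B}"
  proof
    assume "A \<union> B \<in> Q - {A, B}"
    then have "A \<inter> (A \<union> B) = {}" using branch_family_Int[OF Q A(1)] by auto
    then show False using branch_family_nonempty[OF Q A(1)] by blast
  qed
  define f where "f = (\<lambda>X. if X \<in> {A, B} then A \<union> B else X)"
  define R where "R = {(A, B), (B, A)} \<union> Pair B ` ?C \<union> (\<lambda>C. (C, B)) ` ?C"
  have fC: "finite ?C" using fin(1) by (rule finite_subset[rotated]) (auto simp: links_def)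
  have "card (Pair B ` ?C) \<le> card ?C" "card ((\<lambda>C. (C, B)) ` ?C) \<le> card ?C"
    using fC by (rule card_image_le)+
  moreover have "card {(A, B), (B, A)} \<le> 2"
    using card_insert_le_m1[of 2 "{(B, A)}" "(A, B)"] by simp
  moreover have "card R \<le> card {(A, B), (B, A)} + card (Pair B ` ?C) + card ((\<lambda>C. (C, B)) ` ?C)"
    unfolding R_def
    using card_Un_le[of "{(A, B), (B, A)} \<union> Pair B ` ?C" "(\<lambda>C. (C, B)) ` ?C"]
      card_Un_le[of "{(A, B), (B, A)}" "Pair B ` ?C"] by linarith
  ultimately have R: "card R \<le> 2 + 2 * card ?C" by linarith
  have "inj_on (map_prod f f) (links E Q - R)"
  proof (rule inj_onI)
    fix s t assume s: "s \<in> links E Q - R" and t: "t \<in> links E Q - R"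
      and eq: "map_prod f f s = map_prod f f t"
    obtain X Y X' Y' where st: "s = (X, Y)" "t = (X', Y')" by (cases s, cases t) auto
    have f: "f X = f X'" "f Y = f Y'" using eq st by auto
    have m: "X \<in> Q" "Y \<in> Q" "X' \<in> Q" "Y' \<in> Q" "X \<noteq> Y" "X' \<noteq> Y'"
      using s t st by (auto simp: links_def)
    have *: "U = U' \<or> U = A \<and> U' = B \<or> U = B \<and> U' = A" if "f U = f U'" "U \<in> Q" "U' \<in> Q" for U U'
      using that new unfolding f_def by (auto split: if_splits)
    have sL: "(X, Y) \<in> links E Q" "(X', Y') \<in> links E Q" "(Y, X) \<in> links E Q" "(Y', X') \<in> links E Q"
      using s t st links_sym[OF E] by auto
    have nR: "(X, Y) \<notin> R" "(X', Y') \<notin> R" using s t st by auto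
    have r: "(A, B) \<in> R" "(B, A) \<in> R"
      "\<And>C. (A, C) \<in> links E Q \<Longrightarrow> (B, C) \<in> links E Q \<Longrightarrow> (B, C) \<in> R \<and> (C, B) \<in> R"
      by (auto simp: R_def)
    show "s = t" unfolding st
      using *[OF f(1) m(1,3)] *[OF f(2) m(2,4)] sL nR r m by metis
  qed
  moreover have "map_prod f f ` (links E Q - R) \<subseteq> links E ?Q"
  proof
    fix s assume "s \<in> map_prod f f ` (links E Q - R)"
    then obtain X Y where XY: "s = (f X, f Y)" "(X, Y) \<in> links E Q" "(X, Y) \<notin> R" by auto
    then have m: "X \<in> Q" "Y \<in> Q" "X \<noteq> Y" "\<exists>x\<in>X. \<exists>y\<in>Y. (x, y) \<in> E" by (auto simp: links_def)
    have "\<not> (X \<in> {A, B} \<and> Y \<in> {A, B})" using XY(3) m(3) by (auto simp: R_def)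
    then have "f X \<noteq> f Y" using m new by (auto simp: f_def)
    moreover have "f X \<in> ?Q" "f Y \<in> ?Q" using m by (auto simp: f_def)
    moreover have "X \<subseteq> f X" "Y \<subseteq> f Y" by (auto simp: f_def)
    ultimately show "s \<in> links E ?Q" using m(4) XY(1) by (auto simp: links_def)
  qed
  ultimately have "card (links E Q - R) \<le> card (links E ?Q)"
    by (rule card_inj_on_le) (use fin finite_links[of ?Q E] in simp)
  moreover have "card (links E Q) \<le> card (links E Q - R) + card R"
  proof -
    have "finite R" using fC by (simp add: R_def)
    then show ?thesis using diff_card_le_card_Diff[of R "links E Q"] by linarith
  qed
  ultimately show ?thesis using R by linarith
qed

text \<open>In a smallest contraction that is still dense, a link with fewer than \<open>k\<close>
  common neighbours could be contracted: one set disappears with at most 2 + 2(k - 1) = 2k ordered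
  links, so the density bound would persist.\<close>

lemma dense_neighbourhood:
  assumes E: "sym E" and P: "branch_family E P" "P \<noteq> {}" and k: "k > 0"
    and dense: "card (links E P) \<ge> 2 * k * card P"
  obtains Q A where "branch_family E Q" "coarsens Q P" "A \<in> Q" "\<exists>B. (A, B) \<in> links E Q"
    "\<And>B. (A, B) \<in> links E Q \<Longrightarrow> k \<le> card {C. (A, C) \<in> links E Q \<and> (B, C) \<in> links E Q}"
proof -
  define good where "good = (\<lambda>Q. branch_family E Q \<and> Q \<noteq> {} \<and> coarsens Q P \<and> card (links E Q) \<ge> 2 * k * card Q)"
  have "good P" using P dense coarsens_refl by (auto simp: good_def)
  then obtain Q where Q: "good Q" "\<And>Q'. good Q' \<Longrightarrow> card Q \<le> card Q'"
    using ex_has_least_nat[of good P card] by blast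
  have fin: "finite Q" "card Q > 0" using Q(1) by (auto simp: good_def branch_family_def card_gt_0_iff)
  then have "card (links E Q) > 0" using Q(1) k unfolding good_def
    by (metis less_le_trans mult_pos_pos zero_less_numeral)
  then obtain A B where AB: "(A, B) \<in> links E Q" by (metis card.empty equals0I less_irrefl surj_pair)
  show thesis
  proof (rule that[of Q A])
    show "branch_family E Q" "coarsens Q P" using Q(1) by (simp_all add: good_def)
    show "A \<in> Q" using AB by (simp add: links_def)
    show "\<exists>B. (A, B) \<in> links E Q" using AB by blast
    show "k \<le> card {C. (A, C) \<in> links E Q \<and> (B, C) \<in> links E Q}" if AB: "(A, B) \<in> links E Q" for B
    proof (rule ccontr)
      assume few: "\<not> ?thesis"
      let ?Q = "insert (A \<union> B) (Q - {A, B})"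
      have A: "A \<in> Q" "B \<in> Q" "A \<noteq> B" using AB by (auto simp: links_def)
      have "card (Q - {A, B}) + 2 = card Q"
        using A fin by (metis (no_types, lifting) card_2_iff card_Diff_subset card_mono empty_subsetI finite.emptyI finite.insertI insert_subset le_add_diff_inverse2)
      then have c: "card ?Q + 1 \<le> card Q" using fin by (simp add: card_insert_if)
      have "branch_family E ?Q" using branch_family_contract[OF E _ AB] Q(1) by (simp add: good_def)
      moreover have "coarsens ?Q P" using Q(1) A unfolding good_def coarsens_def by blast
      moreover have "2 * k * card ?Q \<le> card (links E ?Q)"
      proof -
        have "2 * k * (card ?Q + 1) \<le> 2 * k * card Q" using c by (intro mult_left_mono) auto
        also have "\<dots> \<le> card (links E Q)" using Q(1) by (simp add: good_def)
        also have "\<dots> \<le> card (links E ?Q) + 2 + 2 * (k - 1)"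
          using card_links_contract[OF E _ AB] Q(1) few unfolding good_def by fastforce
        finally show ?thesis using k by (simp add: algebra_simps)
      qed
      ultimately have "good ?Q" by (auto simp: good_def)
      then show False using Q(2) c by fastforce
    qed
  qed
qed

text \<open>Mader's argument: in a minor with fewest vertices among the dense ones, every edge lies
  in many triangles, so that the neighbourhood of a vertex is again dense.\<close>

lemma dense_clique_minor:
  assumes E: "sym E" and "branch_family E P" "P \<noteq> {}" "card (links E P) \<ge> 2 ^ r * card P"
  shows "\<exists>Q. branch_family E Q \<and> coarsens Q P \<and> card Q = Suc r \<and>
    (\<forall>A\<in>Q. \<forall>B\<in>Q. A \<noteq> B \<longrightarrow> (A, B) \<in> links E Q)"
  using assms(2-)
proof (induction r arbitrary: P)
  case 0
  then obtain A where "A \<in> P" by blast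
  then show ?case using 0(1)
    by (intro exI[of _ "{A}"]) (auto simp: branch_family_def coarsens_def)
next
  case (Suc r)
  \<comment> \<open>The density is halved at each level: 2 ^ (r + 1) = 2 * 2 ^ r is the hypothesis
    for k = 2 ^ r, and \<open>k\<close> becomes the minimum degree within the neighbourhood of
    \<open>A\<close>.\<close>
  obtain Q A where Q: "branch_family E Q" "coarsens Q P" and A: "A \<in> Q" "\<exists>B. (A, B) \<in> links E Q"
    and tri: "\<And>B. (A, B) \<in> links E Q \<Longrightarrow> 2 ^ r \<le> card {C. (A, C) \<in> links E Q \<and> (B, C) \<in> links E Q}"
    using dense_neighbourhood[OF E Suc.prems(1,2), of "2 ^ r"] Suc.prems(3) by auto
  define N where "N = {B. (A, B) \<in> links E Q}"
  have N: "N \<subseteq> Q" "N \<noteq> {}" "A \<notin> N" using A by (auto simp: N_def links_def)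
  have fN: "finite N" using N Q finite_subset by (auto simp: branch_family_def)
  have "links E N = (SIGMA B:N. {C. (A, C) \<in> links E Q \<and> (B, C) \<in> links E Q})"
    using N by (auto simp: links_def N_def)
  moreover have "finite {C. (A, C) \<in> links E Q \<and> (B, C) \<in> links E Q}" for B
    using fN by (rule finite_subset[rotated]) (auto simp: N_def)
  ultimately have "card (links E N) = (\<Sum>B\<in>N. card {C. (A, C) \<in> links E Q \<and> (B, C) \<in> links E Q})"
    using fN by simp
  also have "\<dots> \<ge> (\<Sum>B\<in>N. 2 ^ r)" using tri by (intro sum_mono) (auto simp: N_def)
  finally have "2 ^ r * card N \<le> card (links E N)" by (simp add: mult.commute)
  then obtain R where R: "branch_family E R" "coarsens R N" "card R = Suc r"
      "\<And>A B. A \<in> R \<Longrightarrow> B \<in> R \<Longrightarrow> A \<noteq> B \<Longrightarrow> (A, B) \<in> links E R"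
    using Suc.IH[OF branch_family_subset[OF Q(1) N(1)] N(2)] by blast
  have AN: "A \<inter> \<Union>N = {}" using branch_family_Int[OF Q(1) A(1)] N by blast
  then have AR: "A \<inter> \<Union>R = {}" using R(2) unfolding coarsens_def by blast
  have "A \<noteq> {}" "conn E A" using Q(1) A(1) by (auto simp: branch_family_def)
  then have "A \<notin> R" using AR by blast
  have "branch_family E (insert A R)"
    using R(1) \<open>A \<noteq> {}\<close> \<open>conn E A\<close> AR by (rule branch_family_insert)
  moreover have "coarsens (insert A R) P"
  proof -
    have "coarsens R P" using R(2) N(1) Q(2) coarsens_trans coarsens_subset by blast
    then show ?thesis using Q(2) A(1) unfolding coarsens_def by blast
  qed
  moreover have "card (insert A R) = Suc (Suc r)"
    using R(1,3) \<open>A \<notin> R\<close> by (simp add: branch_family_def)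
  moreover have AB: "(A, B) \<in> links E (insert A R) \<and> (B, A) \<in> links E (insert A R)" if B: "B \<in> R" for B
  proof -
    obtain C where "C \<in> N" "C \<subseteq> B" using R(2) B by (auto simp: coarsens_def)
    then have "(A, B) \<in> links E (insert A R)"
      using B \<open>A \<notin> R\<close> by (auto simp: N_def links_def)
    then show ?thesis using links_sym[OF E] by blast
  qed
  moreover have BC: "(B, C) \<in> links E (insert A R)" if "B \<in> R" "C \<in> R" "B \<noteq> C" for B C
    using R(4)[OF that] by (auto simp: links_def)
  moreover have "\<forall>B\<in>insert A R. \<forall>C\<in>insert A R. B \<noteq> C \<longrightarrow> (B, C) \<in> links E (insert A R)"
    using AB BC by (metis insertE)
  ultimately show ?case by (intro exI[of _ "insert A R"] conjI)
qed

lemma connected_radius_imp_conn: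
  assumes "connected_radius_le (induced_subgraph H S) d" "S \<subseteq> verts H"
  shows "S \<noteq> {}" "conn (adjacency H) S"
proof -
  let ?R = "adjacency H \<inter> S \<times> S"
  have R: "{(x, y). {x, y} \<in> edges (induced_subgraph H S)} = ?R"
    by (auto simp: induced_subgraph_def adjacency_def)
  obtain u where u: "u \<in> S" "\<And>v. v \<in> S \<Longrightarrow> (u, v) \<in> ?R\<^sup>*"
    using assms unfolding connected_radius_le_def within_distance_def R
    by (auto simp: induced_subgraph_def dest!: relpow_imp_rtrancl)
  show "S \<noteq> {}" using u by blast
  have "sym ?R" using sym_adjacency[of H] by (auto simp: sym_def)
  then have "(v, u) \<in> ?R\<^sup>*" if "v \<in> S" for v
    using u(2)[OF that] symD[OF sym_rtrancl] by metis
  then show "conn (adjacency H) S"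
    unfolding conn_def using u(2) rtrancl_trans by metis
qed

lemma card_edges_le_card_links:
  assumes G: "simple_graph G" and E: "sym E" and B: "inj_on B (verts G)"
    and adj: "\<And>u v. {u, v} \<in> edges G \<Longrightarrow> \<exists>x\<in>B u. \<exists>y\<in>B v. (x, y) \<in> E"
  shows "card (edges G) \<le> card (links E (B ` verts G))"
proof -
  have "\<exists>u v. u \<noteq> v \<and> e = {u, v}" if "e \<in> edges G" for e
    using G that unfolding simple_graph_def by (metis card_2_iff)
  then obtain s t where st: "\<And>e. e \<in> edges G \<Longrightarrow> s e \<noteq> t e \<and> e = {s e, t e}" by metis
  have V: "s e \<in> verts G" "t e \<in> verts G" if "e \<in> edges G" for e
    using G st[OF that] that unfolding simple_graph_def by blast+
  have "inj_on (\<lambda>e. (B (s e), B (t e))) (edges G)"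
  proof (rule inj_onI)
    fix e f assume ef: "e \<in> edges G" "f \<in> edges G" "(B (s e), B (t e)) = (B (s f), B (t f))"
    then have "s e = s f" "t e = t f" using B V by (auto dest: inj_onD)
    then show "e = f" using st ef by metis
  qed
  moreover have "(\<lambda>e. (B (s e), B (t e))) ` edges G \<subseteq> links E (B ` verts G)"
  proof
    fix z assume "z \<in> (\<lambda>e. (B (s e), B (t e))) ` edges G"
    then obtain e where e: "e \<in> edges G" "z = (B (s e), B (t e))" by blast
    moreover have "B (s e) \<noteq> B (t e)" using inj_onD[OF B] V[OF e(1)] st[OF e(1)] by blast
    moreover have "{s e, t e} \<in> edges G" using st e(1) by metis
    ultimately show "z \<in> links E (B ` verts G)"
      using adj V[OF e(1)] by (auto simp: links_def)
  qed
  moreover have "finite (links E (B ` verts G))"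
    using G by (intro finite_links) (auto simp: simple_graph_def)
  ultimately show ?thesis using card_inj_on_le by blast
qed

text \<open>The single constant 32 = 2 ^ 5 serves every depth: a nonempty family of density at least
  2 ^ 5 would contain six pairwise linked connected sets.\<close>

lemma planar_bounded_expansion: "bounded_expansion {H :: 'a sgraph. planar H}"
proof -
  have "card (edges G) \<le> 32 * card (verts G)"
    if H: "planar H" and GH: "shallow_minor d G H" for d and G H :: "'a sgraph"
  proof (cases "verts G = {}")
    case True
    then have "edges G = {}" using GH by (fastforce simp: shallow_minor_def simple_graph_def)
    then show ?thesis by simp
  next
    case False
    obtain p \<gamma> where "drawing H p \<gamma>"
      using H unfolding planar_def drawing_def by metis
    then interpret drawing H p \<gamma> .
    let ?E = "adjacency H"
    obtain B where G: "simple_graph G" and disj: "disjoint_family_on B (verts G)"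
      and B: "\<And>v. v \<in> verts G \<Longrightarrow> B v \<subseteq> verts H"
        "\<And>v. v \<in> verts G \<Longrightarrow> connected_radius_le (induced_subgraph H (B v)) d"
      and adj: "\<And>u v. {u, v} \<in> edges G \<Longrightarrow> \<exists>x\<in>B u. \<exists>y\<in>B v. (x, y) \<in> ?E"
      using GH unfolding shallow_minor_def adjacency_def by auto
    have B': "B v \<noteq> {}" "conn ?E (B v)" if "v \<in> verts G" for v
      using connected_radius_imp_conn B that by metis+
    have inj: "inj_on B (verts G)"
    proof (rule inj_onI, rule ccontr)
      fix u v assume "u \<in> verts G" "v \<in> verts G" "B u = B v" "u \<noteq> v"
      then show False using disj B'(1) by (metis Int_absorb disjoint_family_on_def)
    qed
    let ?P = "B ` verts G"
    have P: "branch_family ?E ?P"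
      using G B' disjoint_family_on_disjoint_image[OF disj]
      by (auto simp: branch_family_def simple_graph_def)
    have "card (links ?E ?P) < 2 ^ 5 * card ?P"
    proof (rule ccontr)
      assume "\<not> ?thesis"
      then obtain Q where Q: "branch_family ?E Q" "coarsens Q ?P" "card Q = 6"
          and cl: "\<And>A B. A \<in> Q \<Longrightarrow> B \<in> Q \<Longrightarrow> A \<noteq> B \<Longrightarrow> (A, B) \<in> links ?E Q"
        using dense_clique_minor[OF sym_adjacency P, of 5] False by auto
      obtain h where h: "bij_betw h {0..<6::nat} Q"
        using ex_bij_betw_nat_finite[of Q] Q by (auto simp: branch_family_def)
      have hQ: "h i \<in> Q" if "i < 6" for i using h that by (auto simp: bij_betw_def)
      have ne: "h i \<noteq> h j" if "i < 6" "j < 6" "i \<noteq> j" for i j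
        using h that by (auto simp: bij_betw_def inj_on_def)
      have sub: "h i \<subseteq> verts H" if "i < 6" for i
      proof -
        have "h i \<subseteq> \<Union>?P" using hQ[OF that] Q(2) unfolding coarsens_def by blast
        then show ?thesis using B(1) by blast
      qed
      have hd: "h i \<inter> h j = {}" if "i < 6" "j < 6" "i \<noteq> j" for i j
        using branch_family_Int[OF Q(1) hQ hQ ne] that by blast
      have hc: "conn ?E (h i)" if "i < 6" for i using Q(1) hQ that by (simp add: branch_family_def)
      have he: "\<exists>x\<in>h i. \<exists>y\<in>h j. (x, y) \<in> ?E" if "i < 6" "j < 6" "i \<noteq> j" for i j
        using cl[OF hQ hQ ne] that by (simp add: links_def)
      show False
        \<comment> \<open>The six branch sets are split into indices 0 to 2 and 3 to 5; the links
          across the split form the K_{3,3}.\<close>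
        by (rule no_K33_minor[of h "\<lambda>j. h (j + 3)"]) (use sub hd hc he in auto)
    qed
    moreover have "card (edges G) \<le> card (links ?E ?P)"
      using card_edges_le_card_links[OF G sym_adjacency inj adj] by blast
    ultimately show ?thesis using card_image[OF inj] by simp
  qed
  then have "real (card (edges G)) \<le> 32 * real (card (verts G))"
    if "planar H" "shallow_minor d G H" for d and G H :: "'a sgraph"
    using that by (metis of_nat_le_iff of_nat_mult of_nat_numeral)
  moreover have "simple_graph H" if "planar H" for H :: "'a sgraph"
    using that by (simp add: planar_def)
  ultimately show ?thesis
    unfolding bounded_expansion_def by (intro conjI allI exI[of _ 32]) auto
qed

theorem corollary3:
  shows "(\<forall>C :: 'a sgraph set. bounded_expansion C \<longrightarrow> (\<exists>c. \<forall>G\<in>C. dis G \<le> c)) \<and>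
         (\<exists>c. \<forall>G\<in>{G :: 'a sgraph. planar G}. dis G \<le> c)"
  using bounded_expansion_bounded_dis bounded_expansion_bounded_dis[OF planar_bounded_expansion] by blast

end
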